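(* Let $X$ be a simplicial complex, $i\ge0$ an integer, $\alpha\in H^p(X;\mathbb{Z}_2)$, and let $\pi:S^i\times X\to X$ be the projection onto the second factor. Let $V\subset S^i\times X$ be an open subset. For $\theta\in S^i$ put $V(\theta)=\{x\in X: (\theta,x)\in V\}$, and let $$P[V]=\bigcap_{\theta\in S^i}\big[V(\theta)\cup V(-\theta)\big]\subset X .$$ If $\pi^*(\alpha)$ vanishes on $V$ (i.e. its restriction to $H^p(V;\mathbb{Z}_2)$ is zero), then $Sq_i\alpha$ vanishes on $P[V]$. Moreover, $P[V]$ is open.
   Context: For $\alpha\in H^p(X;\mathbb{Z}_2)$, $Sq_i\alpha$ denotes the Steenrod square $Sq^{p-i}\alpha\in H^{2p-i}(X;\mathbb{Z}_2)$ (zero if $i>p$). A cohomology class vanishes on a subset if its restriction to that subset is zero. *)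

theory Defs
  imports "HOL-Homology.Homology" "HOL-Library.Z2"
begin

section \<open>Simplicial complexes and their geometric realizations\<close>

definition abstract_simplicial_complex :: "'a set set \<Rightarrow> bool" where
  "abstract_simplicial_complex K \<longleftrightarrow>
     (\<forall>s\<in>K. finite s \<and> s \<noteq> {}) \<and> (\<forall>s\<in>K. \<forall>t. t \<subseteq> s \<and> t \<noteq> {} \<longrightarrow> t \<in> K)"

text \<open>Points are given by barycentric coordinates, indexed by the vertices.\<close>

definition closed_simplex :: "'a set \<Rightarrow> ('a \<Rightarrow> real) set" where
  "closed_simplex s =
     {x. (\<forall>v. 0 \<le> x v) \<and> (\<forall>v. v \<notin> s \<longrightarrow> x v = 0) \<and> (\<Sum>v\<in>s. x v) = 1}"

text \<open>The weak (coherent) topology: a set of points is open iff it meets every closed simplex in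
  a set that is open in the Euclidean topology of that simplex. The complex need be neither finite
  nor locally finite.\<close>

definition realization_open :: "'a set set \<Rightarrow> ('a \<Rightarrow> real) set \<Rightarrow> bool" where
  "realization_open K U \<longleftrightarrow>
     U \<subseteq> (\<Union>s\<in>K. closed_simplex s) \<and>
     (\<forall>s\<in>K. openin (subtopology (powertop_real UNIV) (closed_simplex s)) (U \<inter> closed_simplex s))"

definition geometric_realization :: "'a set set \<Rightarrow> ('a \<Rightarrow> real) topology" where
  "geometric_realization K = topology (realization_open K)"

lemma istopology_realization_open: "istopology (realization_open K)"
  unfolding istopology_def
proof (intro conjI allI impI)
  fix S T :: "('a \<Rightarrow> real) set"
  assume S: "realization_open K S" and T: "realization_open K T"
  have eq: "S \<inter> T \<inter> C = (S \<inter> C) \<inter> (T \<inter> C)" for C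
    by blast
  show "realization_open K (S \<inter> T)"
    unfolding realization_open_def eq
    using S T unfolding realization_open_def by (meson inf.coboundedI1 openin_Int)
next
  fix \<U> :: "('a \<Rightarrow> real) set set"
  assume U: "\<forall>U\<in>\<U>. realization_open K U"
  have eq: "\<Union>\<U> \<inter> C = \<Union>((\<lambda>U. U \<inter> C) ` \<U>)" for C
    by blast
  have "openin (subtopology (powertop_real UNIV) (closed_simplex s)) (\<Union>\<U> \<inter> closed_simplex s)"
    if "s \<in> K" for s
    unfolding eq
  proof (rule openin_Union)
    fix W
    assume "W \<in> (\<lambda>U. U \<inter> closed_simplex s) ` \<U>"
    then show "openin (subtopology (powertop_real UNIV) (closed_simplex s)) W"
      using U that unfolding realization_open_def by blast
  qed
  moreover have "\<Union>\<U> \<subseteq> (\<Union>s\<in>K. closed_simplex s)"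
    using U unfolding realization_open_def by blast
  ultimately show "realization_open K (\<Union>\<U>)"
    unfolding realization_open_def by blast
qed

lemma openin_geometric_realization:
  "openin (geometric_realization K) U \<longleftrightarrow> realization_open K U"
  by (simp add: geometric_realization_def topology_inverse' istopology_realization_open)

lemma topspace_geometric_realization:
  "topspace (geometric_realization K) = (\<Union>s\<in>K. closed_simplex s)"
proof
  show "topspace (geometric_realization K) \<subseteq> (\<Union>s\<in>K. closed_simplex s)"
    using openin_topspace[of "geometric_realization K"]
    unfolding openin_geometric_realization realization_open_def by (rule conjunct1)
  have "openin (subtopology (powertop_real UNIV) (closed_simplex t))
          ((\<Union>s\<in>K. closed_simplex s) \<inter> closed_simplex t)" if "t \<in> K" for t
  proof -
    have "(\<Union>s\<in>K. closed_simplex s) \<inter> closed_simplex t = closed_simplex t"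
      using that by blast
    then show ?thesis
      by (metis openin_topspace topspace_subtopology topspace_euclidean euclidean_product_topology Int_UNIV_left)
  qed
  then have "realization_open K (\<Union>s\<in>K. closed_simplex s)"
    unfolding realization_open_def by (intro conjI ballI subset_refl)
  then show "(\<Union>s\<in>K. closed_simplex s) \<subseteq> topspace (geometric_realization K)"
    unfolding openin_geometric_realization[symmetric] by (rule openin_subset)
qed


section \<open>Singular cohomology with coefficients in the field of two elements\<close>

text \<open>A cochain is given by its values on singular simplices; it is normalised to be 0 on
  functions that are not singular \<open>p\<close>-simplices of the space, so that distinct functions are
  distinct cochains.\<close>

type_synonym 'a cochain = "((nat \<Rightarrow> real) \<Rightarrow> 'a) \<Rightarrow> bit"

definition cochain_group :: "nat \<Rightarrow> 'a topology \<Rightarrow> 'a cochain monoid" where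
  "cochain_group p X =
     \<lparr>carrier = {\<phi>. \<forall>\<sigma>. \<phi> \<sigma> \<noteq> 0 \<longrightarrow> singular_simplex p X \<sigma>},
      mult = (\<lambda>\<phi> \<psi> \<sigma>. \<phi> \<sigma> + \<psi> \<sigma>),
      one = (\<lambda>\<sigma>. 0)\<rparr>"

definition coboundary :: "nat \<Rightarrow> 'a topology \<Rightarrow> 'a cochain \<Rightarrow> 'a cochain" where
  "coboundary p X \<phi> =
     (\<lambda>\<sigma>. if singular_simplex (Suc p) X \<sigma>
           then \<Sum>k\<le>Suc p. \<phi> (singular_face (Suc p) k \<sigma>) else 0)"

definition cocycle_group :: "nat \<Rightarrow> 'a topology \<Rightarrow> 'a cochain monoid" where
  "cocycle_group p X =
     (cochain_group p X)
       \<lparr>carrier := {\<phi> \<in> carrier (cochain_group p X). coboundary p X \<phi> = (\<lambda>\<sigma>. 0)}\<rparr>"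

definition coboundaries :: "nat \<Rightarrow> 'a topology \<Rightarrow> 'a cochain set" where
  "coboundaries p X =
     (case p of 0 \<Rightarrow> {\<lambda>\<sigma>. 0} | Suc q \<Rightarrow> coboundary q X ` carrier (cochain_group q X))"

definition cohomology_group :: "nat \<Rightarrow> 'a topology \<Rightarrow> 'a cochain set monoid" where
  "cohomology_group p X = cocycle_group p X Mod coboundaries p X"

definition cohomology_class :: "nat \<Rightarrow> 'a topology \<Rightarrow> 'a cochain \<Rightarrow> 'a cochain set" where
  "cohomology_class p X a = coboundaries p X #>\<^bsub>cocycle_group p X\<^esub> a"

definition cochain_pullback ::
    "nat \<Rightarrow> 'a topology \<Rightarrow> ('a \<Rightarrow> 'b) \<Rightarrow> 'b cochain \<Rightarrow> 'a cochain" where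
  "cochain_pullback p X f \<phi> =
     (\<lambda>\<sigma>. if singular_simplex p X \<sigma> then \<phi> (simplex_map p f \<sigma>) else 0)"

text \<open>The homomorphism induced on the \<open>p\<close>-th cohomology by a continuous map \<open>f\<close> with domain \<open>X\<close>.
  The union is over the cocycles representing the class \<open>\<alpha>\<close>, which all contribute the
  same class of \<open>X\<close>.\<close>

definition cohomology_pullback ::
    "nat \<Rightarrow> 'a topology \<Rightarrow> ('a \<Rightarrow> 'b) \<Rightarrow> 'b cochain set \<Rightarrow> 'a cochain set" where
  "cohomology_pullback p X f \<alpha> = (\<Union>a\<in>\<alpha>. cohomology_class p X (cochain_pullback p X f a))"

definition vanishes_on :: "nat \<Rightarrow> 'a topology \<Rightarrow> 'a set \<Rightarrow> 'a cochain set \<Rightarrow> bool" where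
  "vanishes_on p X S \<alpha> \<longleftrightarrow>
     cohomology_pullback p (subtopology X S) id \<alpha> = \<one>\<^bsub>cohomology_group p (subtopology X S)\<^esub>"


section \<open>Steenrod squares\<close>

text \<open>If \<open>W\<close> is a set of \<open>m + 1\<close> vertices of the standard simplex on which \<open>\<sigma>\<close> is
  defined, then \<open>vertex_face m W \<sigma>\<close> is the restriction of \<open>\<sigma>\<close> to the face spanned by \<open>W\<close>,
  precomposed with the order-preserving affine identification of the standard \<open>m\<close>-simplex with
  that face. (The cardinality below is the position of \<open>v\<close> in \<open>W\<close>, counted from 0.)\<close>

definition vertex_face ::
    "nat \<Rightarrow> nat set \<Rightarrow> ((nat \<Rightarrow> real) \<Rightarrow> 'a) \<Rightarrow> (nat \<Rightarrow> real) \<Rightarrow> 'a" where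
  "vertex_face m W \<sigma> =
     restrict (\<sigma> \<circ> (\<lambda>t v. if v \<in> W then t (card {w \<in> W. w < v}) else 0)) (standard_simplex m)"

text \<open>Write \<open>U = {u\<^sub>1 < \<dots> < u\<^sub>r}\<close>. The two parts of \<open>U\<close> consist of the \<open>u\<^sub>j\<close> with
  \<open>u\<^sub>j + j\<close> even, respectively odd.\<close>

definition index_even :: "nat set \<Rightarrow> nat set" where
  "index_even U = {u \<in> U. even (u + card {w \<in> U. w \<le> u})}"

definition index_odd :: "nat set \<Rightarrow> nat set" where
  "index_odd U = {u \<in> U. odd (u + card {w \<in> U. w \<le> u})}"

text \<open>Steenrod's cup-\<open>i\<close> product of a \<open>p\<close>-cochain \<open>a\<close> and a \<open>q\<close>-cochain \<open>b\<close>, a cochain of degree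
  \<open>n = p + q - i\<close>, in Medina-Mardones' form of the higher diagonals
  \[ \Delta_i[0,\dots,n] = \sum_{|U| = n - i} d_{U^0}[0,\dots,n] \otimes d_{U^1}[0,\dots,n], \]
  where \<open>U\<close> ranges over sets of vertices, \<open>d\<close> deletes vertices, and the superscripts 0 and 1 denote
  the even and odd parts above. The conditions on the cardinalities
  select the terms of bidegree \<open>(p, q)\<close>. For \<open>i = 0\<close> this is the Alexander-Whitney cup product.\<close>

definition cup_i ::
    "nat \<Rightarrow> nat \<Rightarrow> nat \<Rightarrow> 'a topology \<Rightarrow> 'a cochain \<Rightarrow> 'a cochain \<Rightarrow> 'a cochain" where
  "cup_i i p q X a b =
     (let n = p + q - i in
      (\<lambda>\<sigma>. if singular_simplex n X \<sigma>
            then \<Sum>U | U \<subseteq> {..n} \<and> card U + i = n \<and>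
                       card (index_even U) + p = n \<and> card (index_odd U) + q = n.
                   a (vertex_face p ({..n} - index_even U) \<sigma>) *
                   b (vertex_face q ({..n} - index_odd U) \<sigma>)
            else 0))"

text \<open>The Steenrod square of degree \<open>k\<close>, from degree \<open>p\<close> to degree \<open>p + k\<close>: the class of the
  cup-\<open>(p - k)\<close> square of a representing cocycle, and zero for \<open>k > p\<close>. As for pullbacks,
  all representatives contribute the same class to the union.\<close>

definition steenrod_square ::
    "nat \<Rightarrow> nat \<Rightarrow> 'a topology \<Rightarrow> 'a cochain set \<Rightarrow> 'a cochain set" where
  "steenrod_square k p X \<alpha> =
     (if k \<le> p then \<Union>a\<in>\<alpha>. cohomology_class (p + k) X (cup_i (p - k) p p X a a)
      else \<one>\<^bsub>cohomology_group (p + k) X\<^esub>)"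

text \<open>The lower-index square, a class of degree \<open>2 * p - i\<close>. For \<open>i > p\<close> it is zero; only then can
  the subtraction truncate.\<close>

definition lower_square ::
    "nat \<Rightarrow> nat \<Rightarrow> 'a topology \<Rightarrow> 'a cochain set \<Rightarrow> 'a cochain set" where
  "lower_square i p X \<alpha> =
     (if i \<le> p then steenrod_square (p - i) p X \<alpha>
      else \<one>\<^bsub>cohomology_group (2 * p - i) X\<^esub>)"


section \<open>Antipodal slices\<close>

definition antipode :: "(nat \<Rightarrow> real) \<Rightarrow> nat \<Rightarrow> real" where
  "antipode \<theta> = (\<lambda>k. - \<theta> k)"

definition slice :: "('b \<times> 'a) set \<Rightarrow> 'a topology \<Rightarrow> 'b \<Rightarrow> 'a set" where
  "slice V X \<theta> = {x \<in> topspace X. (\<theta>, x) \<in> V}"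

definition antipodal_core ::
    "nat \<Rightarrow> 'a topology \<Rightarrow> ((nat \<Rightarrow> real) \<times> 'a) set \<Rightarrow> 'a set" where
  "antipodal_core i X V =
     (\<Inter>\<theta>\<in>topspace (nsphere i). slice V X \<theta> \<union> slice V X (antipode \<theta>))"

end

theory Submission
  imports Defs "HOL-Analysis.Abstract_Topological_Spaces"
begin

text \<open>
  Let \<open>Y = P[V]\<close>, let \<open>flip\<close> be the antipodal involution of \<open>S\<^sup>i \<times> Y\<close>, and let the cocycle \<open>a\<close>
  represent \<open>\<alpha>\<close>. Since \<open>\<pi>\<^sup>*a\<close> is a coboundary on \<open>V\<close>, it is cohomologous on \<open>S\<^sup>i \<times> Y\<close> to a cocycle
  \<open>u\<close> that vanishes on all simplices in \<open>V\<close>. The cochains \<open>c\<^sub>j = u \<union>\<^sub>j flip\<^sup>* u\<close> satisfy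
  \<open>\<delta> c\<^sub>j = (1 + flip\<^sup>*) c\<^bsub>j - 1\<^esub>\<close>, so they form an equivariant cocycle, and they vanish on all simplices
  that lie in \<open>V\<close> or in \<open>flip V\<close>. Evaluate them on \<open>s\<^bsub>i - j\<^esub> \<times> z\<close>, where \<open>z\<close> is a cycle of \<open>Y\<close> and
  \<open>s\<^sub>k\<close> is a hemisphere chain with \<open>\<partial> s\<^bsub>k + 1\<^esub> = (1 + flip) s\<^sub>k\<close>. The sum over \<open>j\<close> depends only on the
  equivariant class. Hence it is zero, because \<open>V\<close> and \<open>flip V\<close> cover \<open>S\<^sup>i \<times> Y\<close> and barycentric
  subdivision is equivariantly homotopic to the identity. On the other hand \<open>u\<close> may be replaced by
  \<open>\<pi>\<^sup>*a\<close>; then only \<open>j = i\<close> contributes, and the sum is the value of \<open>a \<union>\<^sub>i a\<close> on \<open>z\<close>. A cochain over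
  a field that vanishes on all cycles is a coboundary.
\<close>

text \<open>By default the simplifier turns sums of bits into \<open>xor\<close>, where cancellation is lost.\<close>

declare add_bit_eq_xor [simp del] mult_bit_eq_and [simp del]

lemma bit_add_self [simp]: "(x::bit) + x = 0"
  by (cases x) simp_all

lemma bit_add_cancel [simp]: "(x::bit) + (x + y) = y"
  by (cases x; cases y) simp_all

lemma bit_add_eq_0_iff: "(x::bit) + y = 0 \<longleftrightarrow> x = y"
  by (cases x; cases y) simp_all

subsection \<open>Boundaries of vertex lists\<close>

text \<open>Written as a recursion so that it unfolds in step with \<open>diag\<close> and
  \<open>shuffle_sum\<close>, which also consume lists from the front. A one-element list has the
  empty list as its face, so this is the augmented boundary.\<close>

fun list_bd :: "('v list \<Rightarrow> bit) \<Rightarrow> 'v list \<Rightarrow> bit" where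
  "list_bd G [] = 0"
| "list_bd G (v # vs) = G vs + list_bd (\<lambda>l. G (v # l)) vs"

lemma list_bd_eq_sum:
  "list_bd G vs = (\<Sum>k<length vs. G (take k vs @ drop (Suc k) vs))"
  by (induction vs arbitrary: G) (simp_all add: sum.lessThan_Suc_shift del: sum.lessThan_Suc)

lemma list_bd_add: "list_bd (\<lambda>l. G l + H l) vs = list_bd G vs + list_bd H vs"
  by (simp add: list_bd_eq_sum sum.distrib)

lemma list_bd_zero [simp]: "list_bd (\<lambda>l. 0) vs = 0"
  by (simp add: list_bd_eq_sum)

text \<open>The \<open>k\<close>-th coface map on vertices.\<close>

definition skip :: "nat \<Rightarrow> nat \<Rightarrow> nat" where
  "skip k v = (if v < k then v else Suc v)"

lemma map_skip_upt:
  assumes "k \<le> n"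
  shows "map (skip k) [0..<n] = take k [0..<Suc n] @ drop (Suc k) [0..<Suc n]"
  using assms by (auto simp: list_eq_iff_nth_eq nth_append skip_def simp del: upt_Suc)

lemma list_bd_upt:
  "list_bd G [0..<Suc n] = (\<Sum>k\<le>n. G (map (skip k) [0..<n]))"
  unfolding list_bd_eq_sum by (simp add: map_skip_upt lessThan_Suc_atMost del: upt_Suc)

subsection \<open>Diagonals\<close>

text \<open>A two-state automaton for Steenrod's overlapping intervals. In state
  \<open>False\<close> a vertex goes to the left factor only, in state \<open>True\<close> to the
  right factor only; a vertex put into both factors switches the state. The list is thus cut into
  intervals with common end points, assigned alternately to the two factors, and \<open>j\<close> is
  the number of common vertices.\<close>

fun diag :: "bool \<Rightarrow> 'v list \<Rightarrow> nat \<Rightarrow> ('v list \<Rightarrow> 'v list \<Rightarrow> bit) \<Rightarrow> bit" where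
  "diag s [] j G = (if j = 0 then G [] [] else 0)"
| "diag s (v # vs) j G =
     diag s vs j (if s then (\<lambda>A B. G A (v # B)) else (\<lambda>A B. G (v # A) B)) +
     (if j = 0 then 0 else diag (\<not> s) vs (j - 1) (\<lambda>A B. G (v # A) (v # B)))"

lemma diag_cong:
  assumes "\<And>A B. \<lbrakk>set A \<subseteq> set vs; set B \<subseteq> set vs; length A + length B = length vs + j\<rbrakk> \<Longrightarrow> G A B = H A B"
  shows "diag s vs j G = diag s vs j H"
  using assms
proof (induction vs arbitrary: s j G H)
  case (Cons v vs)
  have 1: "diag s vs j (if s then (\<lambda>A B. G A (v # B)) else (\<lambda>A B. G (v # A) B))
         = diag s vs j (if s then (\<lambda>A B. H A (v # B)) else (\<lambda>A B. H (v # A) B))"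
    by (rule Cons.IH) (auto intro!: Cons.prems)
  have 2: "diag (\<not> s) vs (j - 1) (\<lambda>A B. G (v # A) (v # B)) = diag (\<not> s) vs (j - 1) (\<lambda>A B. H (v # A) (v # B))"
    if "j \<noteq> 0"
    by (rule Cons.IH) (use that in \<open>auto intro!: Cons.prems\<close>)
  show ?case
    using 1 2 by simp
qed auto

lemma diag_add: "diag s vs j (\<lambda>A B. G A B + H A B) = diag s vs j G + diag s vs j H"
proof (induction vs arbitrary: s j G H)
  case (Cons v vs)
  show ?case
    by (cases s) (simp_all add: Cons.IH algebra_simps)
qed auto

lemma diag_zero [simp]: "diag s vs j (\<lambda>A B. 0) = 0"
  by (induction vs arbitrary: s j) auto

lemma diag_swap: "diag (\<not> s) vs j G = diag s vs j (\<lambda>A B. G B A)"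
proof (induction vs arbitrary: s j G)
  case (Cons v vs)
  show ?case
    using Cons.IH[of s] Cons.IH[of "\<not> s"] by (cases s) simp_all
qed auto

lemma diag_map: "diag s (map f vs) j G = diag s vs j (\<lambda>A B. G (map f A) (map f B))"
  by (induction vs arbitrary: s j G) (auto simp: if_distrib fun_eq_iff cong: if_cong)

lemma diag_zero_left: "diag False vs 0 G = G vs []"
  by (induction vs arbitrary: G) auto

definition tensor_bd :: "('v list \<Rightarrow> 'v list \<Rightarrow> bit) \<Rightarrow> 'v list \<Rightarrow> 'v list \<Rightarrow> bit" where
  "tensor_bd G A B = list_bd (\<lambda>A. G A B) A + list_bd (G A) B"

lemma tensor_bd_Cons_left: "tensor_bd G (v # A) B = G A B + tensor_bd (\<lambda>A. G (v # A)) A B"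
  by (simp add: tensor_bd_def algebra_simps)

lemma tensor_bd_Cons_right: "tensor_bd G A (v # B) = G A B + tensor_bd (\<lambda>A B. G A (v # B)) A B"
  by (simp add: tensor_bd_def algebra_simps)

text \<open>Reading a word from left to right is multiplication by the matrices
  \<open>M = ((x, z), (z, y))\<close>, where \<open>x\<close>, \<open>y\<close>, \<open>z\<close> put the current vertex into the left, the right or
  both factors. Deleting a doubled vertex from either factor turns \<open>M\<close> into
  \<open>((0, x + y), (x + y, 0)) = P M + M P\<close> for the swap \<open>P\<close>, so that these terms telescope.\<close>

lemma diag_boundary:
  "diag s vs j (tensor_bd G) =
   list_bd (\<lambda>us. diag s us j G) vs +
   (if j = 0 then 0 else diag s vs (j - 1) G + diag (\<not> s) vs (j - 1) G)"
proof (induction vs arbitrary: s j G)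
  case Nil
  then show ?case by (auto simp: tensor_bd_def)
next
  case (Cons v vs)
  have *: "(\<lambda>A B. tensor_bd G (v # A) (v # B)) =
      (\<lambda>A B. (G A (v # B) + G (v # A) B) + tensor_bd (\<lambda>A B. G (v # A) (v # B)) A B)"
    by (simp add: fun_eq_iff tensor_bd_Cons_left tensor_bd_Cons_right)
  have **: "(\<lambda>A. tensor_bd G (v # A)) = (\<lambda>A B. G A B + tensor_bd (\<lambda>A. G (v # A)) A B)"
    by (simp add: fun_eq_iff tensor_bd_Cons_left)
  show ?case
    by (cases s; cases j)
       (simp_all add: Cons.IH * ** tensor_bd_Cons_left tensor_bd_Cons_right diag_add list_bd_add algebra_simps)
qed

subsection \<open>Shuffles\<close>

text \<open>The Eilenberg-Zilber shuffle product: the sum runs over the monotone lattice paths from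
  the first pair of vertices to the last, that is, over the top simplices of the triangulated
  product of two simplices.\<close>

fun shuffle_sum :: "'x list \<Rightarrow> 'y list \<Rightarrow> (('x \<times> 'y) list \<Rightarrow> bit) \<Rightarrow> bit" where
  "shuffle_sum (x # xs) (y # ys) G =
     (if xs = [] \<and> ys = [] then G [(x, y)]
      else shuffle_sum xs (y # ys) (\<lambda>l. G ((x, y) # l)) + shuffle_sum (x # xs) ys (\<lambda>l. G ((x, y) # l)))"
| "shuffle_sum [] ys G = 0"
| "shuffle_sum xs [] G = 0"

lemma shuffle_sum_Nil2 [simp]: "shuffle_sum xs [] G = 0"
  by (cases xs) auto

lemma shuffle_sum_cong:
  assumes "\<And>l. \<lbrakk>set l \<subseteq> set xs \<times> set ys; Suc (length l) = length xs + length ys\<rbrakk> \<Longrightarrow> G l = H l"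
  shows "shuffle_sum xs ys G = shuffle_sum xs ys H"
  using assms
proof (induction xs ys G arbitrary: H rule: shuffle_sum.induct)
  case (1 x xs y ys G)
  show ?case
  proof (cases "xs = [] \<and> ys = []")
    case True
    then show ?thesis
      using "1.prems"[of "[(x, y)]"] by simp
  next
    case False
    have "shuffle_sum xs (y # ys) (\<lambda>l. G ((x, y) # l)) = shuffle_sum xs (y # ys) (\<lambda>l. H ((x, y) # l))"
      by (rule "1.IH"(1)[OF False]) (rule "1.prems"; force)
    moreover have "shuffle_sum (x # xs) ys (\<lambda>l. G ((x, y) # l)) = shuffle_sum (x # xs) ys (\<lambda>l. H ((x, y) # l))"
      by (rule "1.IH"(2)[OF False]) (rule "1.prems"; force)
    ultimately show ?thesis
      using False by auto
  qed
qed auto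

lemma shuffle_sum_add:
  "shuffle_sum xs ys (\<lambda>l. G l + H l) = shuffle_sum xs ys G + shuffle_sum xs ys H"
proof (induction xs ys G arbitrary: H rule: shuffle_sum.induct)
  case (1 x xs y ys G)
  show ?case
  proof (cases "xs = [] \<and> ys = []")
    case False
    show ?thesis
      unfolding shuffle_sum.simps if_not_P[OF False] "1.IH"[OF False] by (simp add: add_ac)
  qed auto
qed auto

lemma shuffle_sum_zero [simp]: "shuffle_sum xs ys (\<lambda>l. 0) = 0"
  by (induction xs ys "\<lambda>l :: ('a \<times> 'b) list. 0 :: bit" rule: shuffle_sum.induct) auto

lemma shuffle_sum_map:
  "shuffle_sum (map f xs) (map g ys) G = shuffle_sum xs ys (\<lambda>l. G (map (map_prod f g) l))"
  by (induction xs ys "\<lambda>l. G (map (map_prod f g) l)" arbitrary: G rule: shuffle_sum.induct)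
     (auto simp: map_prod_def)

lemma shuffle_sum_singleton:
  "ys \<noteq> [] \<Longrightarrow> shuffle_sum [x] ys G = G (map (Pair x) ys)"
  by (induction ys arbitrary: G) auto

text \<open>Deleting a corner of a path gives the same list as deleting the opposite corner of the
  neighbouring path, so interior faces cancel; the other deletions remove a whole row or column. The
  last summand is the empty face of a single point, which the augmented \<open>list_bd\<close>
  counts on the left only.\<close>

lemma shuffle_sum_boundary:
  "shuffle_sum xs ys (list_bd G) =
   list_bd (\<lambda>us. shuffle_sum us ys G) xs + list_bd (\<lambda>us. shuffle_sum xs us G) ys +
   (if length xs = 1 \<and> length ys = 1 then G [] else 0)"
proof (induction xs ys G rule: shuffle_sum.induct)
  case (1 x xs y ys G)
  let ?G = "\<lambda>l. G ((x, y) # l)"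
  show ?case
  proof (cases "xs = [] \<and> ys = []")
    case True
    then show ?thesis by simp
  next
    case False
    \<comment> \<open>The recursive equation for \<open>shuffle_sum\<close> breaks down when both
      tails are empty. The conditional summand corrects for this and later cancels against the one
      in the induction hypothesis.\<close>
    have a: "list_bd (\<lambda>us. shuffle_sum (x # us) (y # ys) G) xs =
        list_bd (\<lambda>us. shuffle_sum us (y # ys) ?G) xs + list_bd (\<lambda>us. shuffle_sum (x # us) ys ?G) xs
        + (if length xs = 1 \<and> ys = [] then G [(x, y)] else 0)"
      unfolding list_bd_add[symmetric]
      by (cases "ys = []"; cases xs; cases "tl xs") (auto simp: list_bd_eq_sum intro!: sum.cong)
    have b: "list_bd (\<lambda>us. shuffle_sum (x # xs) (y # us) G) ys =
        list_bd (\<lambda>us. shuffle_sum xs (y # us) ?G) ys + list_bd (\<lambda>us. shuffle_sum (x # xs) us ?G) ys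
        + (if length ys = 1 \<and> xs = [] then G [(x, y)] else 0)"
      unfolding list_bd_add[symmetric]
      by (cases "xs = []"; cases ys; cases "tl ys") (auto simp: list_bd_eq_sum intro!: sum.cong)
    have step: "shuffle_sum (x # xs) (y # ys) H =
        shuffle_sum xs (y # ys) (\<lambda>l. H ((x, y) # l)) + shuffle_sum (x # xs) ys (\<lambda>l. H ((x, y) # l))" for H
      using False by auto
    show ?thesis
      unfolding step list_bd.simps a b shuffle_sum_add "1.IH"[OF False]
      using False by (auto simp: add_ac)
  qed
qed auto

subsection \<open>Faces spanned by vertex lists and cup-i products\<close>

text \<open>The affine map that sends the \<open>j\<close>-th vertex of a standard simplex to the
  vertex \<open>vs ! j\<close>. Repeated entries are allowed, because the projections of a shuffle
  path to the two factors repeat vertices.\<close>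

definition bary :: "'v list \<Rightarrow> (nat \<Rightarrow> real) \<Rightarrow> 'v \<Rightarrow> real" where
  "bary vs t v = (\<Sum>j<length vs. if vs ! j = v then t j else 0)"

lemma sum_skip:
  fixes f :: "nat \<Rightarrow> 'c::comm_monoid_add"
  assumes "k \<le> r"
  shows "(\<Sum>j<Suc r. f j) = f k + (\<Sum>j<r. f (skip k j))"
proof -
  have "skip k j \<in> {..<Suc r}" if "j < r" for j
    using that by (auto simp: skip_def)
  moreover have "j \<in> insert k (skip k ` {..<r})" if "j < Suc r" for j
  proof (cases j k rule: linorder_cases)
    case less
    then have "skip k j = j" "j < r"
      using assms by (auto simp: skip_def)
    then show ?thesis
      by (metis imageI insertCI lessThan_iff)
  next
    case greater
    then have "skip k (j - 1) = j" "j - 1 < r"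
      using that by (auto simp: skip_def)
    then show ?thesis
      by (metis imageI insertCI lessThan_iff)
  qed auto
  ultimately have eq: "{..<Suc r} = insert k (skip k ` {..<r})"
    using assms by auto
  have inj: "inj_on (skip k) {..<r}"
    by (auto simp: inj_on_def skip_def split: if_splits)
  have "k \<notin> skip k ` {..<r}"
    by (auto simp: skip_def)
  then show ?thesis
    unfolding eq by (simp add: sum.reindex[OF inj])
qed

lemma nth_delete: "\<lbrakk>length vs = Suc r; k \<le> r; j < r\<rbrakk> \<Longrightarrow> (take k vs @ drop (Suc k) vs) ! j = vs ! skip k j"
  by (auto simp: nth_append skip_def)

lemma bary_simplical_face:
  assumes "length vs = Suc r" "k \<le> r"
  shows "bary vs (simplical_face k t) = bary (take k vs @ drop (Suc k) vs) t"
proof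
  fix v
  have face: "simplical_face k t (skip k j) = t j" for j
    by (auto simp: simplical_face_def skip_def)
  have len: "length (take k vs @ drop (Suc k) vs) = r"
    using assms by simp
  have "bary vs (simplical_face k t) v =
      (\<Sum>j<r. if vs ! skip k j = v then simplical_face k t (skip k j) else 0)"
    unfolding bary_def assms(1) by (subst sum_skip[OF assms(2)]) (simp add: simplical_face_def)
  also have "\<dots> = bary (take k vs @ drop (Suc k) vs) t v"
    unfolding bary_def len by (rule sum.cong) (simp_all only: face nth_delete[OF assms] lessThan_iff)
  finally show "bary vs (simplical_face k t) v = bary (take k vs @ drop (Suc k) vs) t v" .
qed

lemma simplical_face_bary: "simplical_face k (bary vs t) = bary (map (skip k) vs) t"
proof
  fix v
  show "simplical_face k (bary vs t) v = bary (map (skip k) vs) t v"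
    by (cases v k rule: linorder_cases)
       (auto simp: simplical_face_def bary_def skip_def intro!: sum.cong sum.neutral)
qed

lemma bary_nonneg: "t \<in> standard_simplex r \<Longrightarrow> 0 \<le> bary vs t v"
  by (auto simp: bary_def standard_simplex_def intro!: sum_nonneg)

lemma bary_eq_0: "v \<notin> set vs \<Longrightarrow> bary vs t v = 0"
  by (auto simp: bary_def intro!: sum.neutral)

lemma sum_bary:
  assumes "t \<in> standard_simplex (length vs - 1)" "set vs \<subseteq> B" "finite B" "vs \<noteq> []"
  shows "(\<Sum>v\<in>B. bary vs t v) = 1"
proof -
  have "(\<Sum>v\<in>B. bary vs t v) = (\<Sum>j<length vs. \<Sum>v\<in>B. if vs ! j = v then t j else 0)"
    unfolding bary_def by (rule sum.swap)
  also have "\<dots> = (\<Sum>j<length vs. t j)"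
    using assms by (intro sum.cong refl) (auto simp: sum.delta' subset_iff)
  also have "\<dots> = (\<Sum>j\<le>length vs - 1. t j)"
    using assms(4) by (intro sum.cong) (auto simp: Suc_le_eq less_Suc_eq_le[symmetric])
  finally show ?thesis
    using assms(1) by (simp add: standard_simplex_def)
qed

lemma bary_in_standard_simplex:
  assumes t: "t \<in> standard_simplex (length vs - 1)" and vs: "set vs \<subseteq> {..n}" "vs \<noteq> []"
  shows "bary vs t \<in> standard_simplex n"
proof -
  have s: "(\<Sum>v\<le>n. bary vs t v) = 1"
    using sum_bary[OF t vs(1) _ vs(2)] by simp
  have le: "bary vs t v \<le> 1" for v
  proof (cases "v \<le> n")
    case True
    then have "bary vs t v \<le> (\<Sum>v\<le>n. bary vs t v)"
      using bary_nonneg[OF t] by (intro member_le_sum) auto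
    then show ?thesis
      by (simp only: s)
  next
    case False
    then have "v \<notin> set vs"
      using vs by auto
    then show ?thesis
      by (simp add: bary_eq_0)
  qed
  have "bary vs t v = 0" if "v > n" for v
    using vs that by (intro bary_eq_0) auto
  then show ?thesis
    unfolding standard_simplex_def mem_Collect_eq by (intro conjI allI impI s le bary_nonneg[OF t])
qed

lemma bary_upt:
  assumes "t \<in> standard_simplex n"
  shows "bary [0..<Suc n] t = t"
proof
  fix v
  have "bary [0..<Suc n] t v = (\<Sum>j<Suc n. if j = v then t j else 0)"
    unfolding bary_def by (intro sum.cong) (auto simp del: upt_Suc)
  also have "\<dots> = (if v < Suc n then t v else 0)"
    by (simp del: sum.lessThan_Suc)
  also have "\<dots> = t v"
    using assms by (auto simp: standard_simplex_def)
  finally show "bary [0..<Suc n] t v = t v" .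
qed

lemma continuous_map_bary_component:
  "continuous_map (subtopology (powertop_real UNIV) S) euclideanreal (\<lambda>t. bary vs t v)"
proof -
  have "continuous_map (powertop_real UNIV) euclideanreal (\<lambda>t. if b then t j else 0)" for b and j :: nat
    by (cases b) (auto intro: continuous_map_product_projection)
  then show ?thesis
    unfolding bary_def
    by (intro continuous_map_from_subtopology continuous_map_sum) auto
qed

section \<open>Restriction of singular simplices along vertex lists\<close>

definition list_face :: "nat list \<Rightarrow> ((nat \<Rightarrow> real) \<Rightarrow> 'a) \<Rightarrow> (nat \<Rightarrow> real) \<Rightarrow> 'a" where
  "list_face vs \<sigma> = restrict (\<sigma> \<circ> bary vs) (standard_simplex (length vs - 1))"

lemma singular_face_list_face:
  assumes "length vs = Suc r" "1 \<le> r" "k \<le> r"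
  shows "singular_face r k (list_face vs \<sigma>) = list_face (take k vs @ drop (Suc k) vs) \<sigma>"
  using assms simplical_face_in_standard_simplex[of r k]
  by (auto simp: singular_face_def list_face_def fun_eq_iff bary_simplical_face)

lemma list_face_singular_face:
  assumes "set vs \<subseteq> {..n}" "vs \<noteq> []"
  shows "list_face vs (singular_face (Suc n) k \<sigma>) = list_face (map (skip k) vs) \<sigma>"
  using assms bary_in_standard_simplex[of _ vs n]
  by (auto simp: singular_face_def list_face_def fun_eq_iff simplical_face_bary)

lemma list_face_simplex_map:
  assumes "set vs \<subseteq> {..n}" "vs \<noteq> []"
  shows "list_face vs (simplex_map n f \<sigma>) = simplex_map (length vs - 1) f (list_face vs \<sigma>)"
  using assms bary_in_standard_simplex[of _ vs n]
  by (auto simp: simplex_map_def list_face_def fun_eq_iff)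

lemma list_face_upt:
  assumes "singular_simplex n X \<sigma>"
  shows "list_face [0..<Suc n] \<sigma> = \<sigma>"
proof -
  have "\<sigma> \<in> extensional (standard_simplex n)"
    using assms by (simp add: singular_simplex_def)
  then show ?thesis
    by (auto simp: list_face_def fun_eq_iff bary_upt extensional_def simp del: upt_Suc)
qed

lemma singular_simplex_list_face:
  assumes "singular_simplex n X \<sigma>" "set vs \<subseteq> {..n}" "vs \<noteq> []" "length vs = Suc r"
  shows "singular_simplex r X (list_face vs \<sigma>)"
proof -
  have "continuous_map (subtopology (powertop_real UNIV) (standard_simplex r))
          (subtopology (powertop_real UNIV) (standard_simplex n)) (bary vs)"
    using bary_in_standard_simplex[OF _ assms(2,3)] assms(4)
    by (auto simp: continuous_map_in_subtopology continuous_map_componentwise_UNIV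
        continuous_map_bary_component)
  moreover have "continuous_map (subtopology (powertop_real UNIV) (standard_simplex n)) X \<sigma>"
    using assms(1) by (simp add: singular_simplex_def)
  ultimately have "continuous_map (subtopology (powertop_real UNIV) (standard_simplex r)) X (\<sigma> \<circ> bary vs)"
    by (rule continuous_map_compose)
  then show ?thesis
    using assms(4) by (simp add: singular_simplex_def list_face_def)
qed

text \<open>Unlike \<open>coboundary\<close>, this is not normalised off the singular simplices and
  so depends on no space. The index \<open>n\<close> is the dimension of the simplex at which the
  result is evaluated; for \<open>n = 0\<close> the value is 0, so there is no augmentation.\<close>

definition cobd :: "nat \<Rightarrow> 'a cochain \<Rightarrow> 'a cochain" where
  "cobd n \<phi> \<sigma> = (if n = 0 then 0 else \<Sum>k\<le>n. \<phi> (singular_face n k \<sigma>))"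

text \<open>\<open>P\<close> counts vertices, so the degree is \<open>P - 1\<close>. The value 0 on
  lists of other lengths makes \<open>diag\<close> select the terms of the right bidegree by
  itself.\<close>

definition list_cochain :: "nat \<Rightarrow> 'a cochain \<Rightarrow> ((nat \<Rightarrow> real) \<Rightarrow> 'a) \<Rightarrow> nat list \<Rightarrow> bit" where
  "list_cochain P \<phi> \<sigma> l = (if length l = P then \<phi> (list_face l \<sigma>) else 0)"

text \<open>The case \<open>P = 0\<close> is excluded because \<open>list_bd\<close> is augmented
  and \<open>cobd\<close> is not.\<close>

lemma list_bd_list_cochain:
  assumes "P \<ge> 1"
  shows "list_bd (list_cochain P \<phi> \<sigma>) l = list_cochain (Suc P) (cobd P \<phi>) \<sigma> l"
proof (cases "length l = Suc P")
  case True
  have "list_bd (list_cochain P \<phi> \<sigma>) l = (\<Sum>k<Suc P. \<phi> (list_face (take k l @ drop (Suc k) l) \<sigma>))"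
    unfolding list_bd_eq_sum using True by (intro sum.cong) (auto simp: list_cochain_def)
  also have "\<dots> = (\<Sum>k\<le>P. \<phi> (singular_face P k (list_face l \<sigma>)))"
    unfolding lessThan_Suc_atMost using True assms by (intro sum.cong) (auto simp: singular_face_list_face)
  finally show ?thesis
    using True assms by (simp add: list_cochain_def cobd_def)
next
  case False
  then show ?thesis
    unfolding list_bd_eq_sum by (auto simp: list_cochain_def intro!: sum.neutral)
qed

text \<open>The product \<open>a \<union>\<^sub>i b\<close> is \<open>cup (Suc i)\<close>, with degrees replaced by the numbers \<open>P\<close> and \<open>Q\<close>
  of vertices. The shift makes room for \<open>\<union>\<^sub>-\<^sub>1 = 0\<close>.\<close>

definition cup :: "nat \<Rightarrow> nat \<Rightarrow> nat \<Rightarrow> nat \<Rightarrow> 'a cochain \<Rightarrow> 'a cochain \<Rightarrow> 'a cochain" where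
  "cup J P Q n a b \<sigma> =
     diag False [0..<Suc n] J (\<lambda>A B. list_cochain P a \<sigma> A * list_cochain Q b \<sigma> B)"

lemma cup_0: "Q \<ge> 1 \<Longrightarrow> cup 0 P Q n a b \<sigma> = 0"
  unfolding cup_def diag_zero_left by (simp add: list_cochain_def)

lemma cup_add_left: "cup J P Q n (\<lambda>\<sigma>. a \<sigma> + a' \<sigma>) b \<sigma> = cup J P Q n a b \<sigma> + cup J P Q n a' b \<sigma>"
  unfolding cup_def diag_add[symmetric]
  by (rule arg_cong[where f = "diag _ _ _"]) (auto simp: fun_eq_iff list_cochain_def algebra_simps)

lemma cup_add_right: "cup J P Q n a (\<lambda>\<sigma>. b \<sigma> + b' \<sigma>) \<sigma> = cup J P Q n a b \<sigma> + cup J P Q n a b' \<sigma>"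
  unfolding cup_def diag_add[symmetric]
  by (rule arg_cong[where f = "diag _ _ _"]) (auto simp: fun_eq_iff list_cochain_def algebra_simps)

lemma cup_cong:
  assumes \<sigma>: "singular_simplex n X \<sigma>" and "P \<ge> 1" "Q \<ge> 1"
    and a: "\<And>\<tau>. singular_simplex (P - 1) X \<tau> \<Longrightarrow> a \<tau> = a' \<tau>"
    and b: "\<And>\<tau>. singular_simplex (Q - 1) X \<tau> \<Longrightarrow> b \<tau> = b' \<tau>"
  shows "cup J P Q n a b \<sigma> = cup J P Q n a' b' \<sigma>"
  unfolding cup_def
proof (rule diag_cong)
  have *: "list_cochain R c \<sigma> A = list_cochain R c' \<sigma> A"
    if A: "set A \<subseteq> set [0..<Suc n]" and R: "R \<ge> 1"
      and c: "\<And>\<tau>. singular_simplex (R - 1) X \<tau> \<Longrightarrow> c \<tau> = c' \<tau>" for R c c' A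
  proof (cases "length A = R")
    case True
    have "singular_simplex (R - 1) X (list_face A \<sigma>)"
      using A R True by (intro singular_simplex_list_face[OF \<sigma>]) auto
    then show ?thesis
      by (simp add: list_cochain_def c)
  qed (simp add: list_cochain_def)
  show "list_cochain P a \<sigma> A * list_cochain Q b \<sigma> B = list_cochain P a' \<sigma> A * list_cochain Q b' \<sigma> B"
    if "set A \<subseteq> set [0..<Suc n]" "set B \<subseteq> set [0..<Suc n]" for A B
    using *[OF that(1) \<open>P \<ge> 1\<close> a] *[OF that(2) \<open>Q \<ge> 1\<close> b] by simp
qed

lemma cup_zero_left [simp]: "cup J P Q n (\<lambda>\<sigma>. 0) b \<sigma> = 0"
  by (simp add: cup_def list_cochain_def cong: if_cong)

lemma cup_zero_right [simp]: "cup J P Q n a (\<lambda>\<sigma>. 0) \<sigma> = 0"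
  by (simp add: cup_def list_cochain_def cong: if_cong)

lemma cup_simplex_map:
  assumes "P \<ge> 1" "Q \<ge> 1"
  shows "cup J P Q n a b (simplex_map n f \<sigma>) =
    cup J P Q n (\<lambda>\<tau>. a (simplex_map (P - 1) f \<tau>)) (\<lambda>\<tau>. b (simplex_map (Q - 1) f \<tau>)) \<sigma>"
  unfolding cup_def
proof (rule diag_cong)
  have *: "list_cochain R c (simplex_map n f \<sigma>) A = list_cochain R (\<lambda>\<tau>. c (simplex_map (R - 1) f \<tau>)) \<sigma> A"
    if A: "set A \<subseteq> set [0..<Suc n]" and R: "R \<ge> 1" for R c A
  proof (cases "length A = R")
    case True
    have "list_face A (simplex_map n f \<sigma>) = simplex_map (R - 1) f (list_face A \<sigma>)"
      using A R True by (subst list_face_simplex_map) (auto simp: less_Suc_eq_le)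
    then show ?thesis
      by (simp add: list_cochain_def)
  qed (simp add: list_cochain_def)
  show "list_cochain P a (simplex_map n f \<sigma>) A * list_cochain Q b (simplex_map n f \<sigma>) B =
      list_cochain P (\<lambda>\<tau>. a (simplex_map (P - 1) f \<tau>)) \<sigma> A * list_cochain Q (\<lambda>\<tau>. b (simplex_map (Q - 1) f \<tau>)) \<sigma> B"
    if "set A \<subseteq> set [0..<Suc n]" "set B \<subseteq> set [0..<Suc n]" for A B
    using *[OF that(1) assms(1)] *[OF that(2) assms(2)] by simp
qed

text \<open>Steenrod's coboundary formula, obtained by evaluating \<open>diag_boundary\<close> on
  the tensor product of \<open>a\<close> and \<open>b\<close>; \<open>diag_swap\<close> interchanges
  the factors in the last term. For \<open>J = 0\<close> the truncated \<open>J - 1\<close> is 0,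
  and the last two terms vanish by \<open>cup_0\<close>.\<close>

lemma cobd_cup:
  assumes P: "P \<ge> 1" and Q: "Q \<ge> 1"
  shows "cobd n (cup J P Q (n - 1) a b) \<sigma> =
    cup J (Suc P) Q n (cobd P a) b \<sigma> + cup J P (Suc Q) n a (cobd Q b) \<sigma> +
    cup (J - 1) P Q n a b \<sigma> + cup (J - 1) Q P n b a \<sigma>"
proof -
  let ?G = "\<lambda>\<sigma> A B. list_cochain P a \<sigma> A * list_cochain Q b \<sigma> B"
  have "tensor_bd (?G \<sigma>) = (\<lambda>A B. list_cochain (Suc P) (cobd P a) \<sigma> A * list_cochain Q b \<sigma> B
       + list_cochain P a \<sigma> A * list_cochain (Suc Q) (cobd Q b) \<sigma> B)"
    unfolding fun_eq_iff tensor_bd_def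
    by (simp flip: list_bd_list_cochain[OF P] list_bd_list_cochain[OF Q]
             add: list_bd_eq_sum sum_distrib_left sum_distrib_right)
  then have "cup J (Suc P) Q n (cobd P a) b \<sigma> + cup J P (Suc Q) n a (cobd Q b) \<sigma> =
       diag False [0..<Suc n] J (tensor_bd (?G \<sigma>))"
    by (simp add: cup_def diag_add del: upt_Suc)
  also have "\<dots> = list_bd (\<lambda>us. diag False us J (?G \<sigma>)) [0..<Suc n] +
     (cup (J - 1) P Q n a b \<sigma> + cup (J - 1) Q P n b a \<sigma>)"
  proof (cases "J = 0")
    case True
    then show ?thesis
      by (simp add: diag_boundary cup_0[OF P] cup_0[OF Q] del: upt_Suc)
  next
    case False
    then show ?thesis
      using diag_swap[of False "[0..<Suc n]" "J - 1" "?G \<sigma>"]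
      by (simp add: diag_boundary cup_def mult.commute del: upt_Suc)
  qed
  also have "list_bd (\<lambda>us. diag False us J (?G \<sigma>)) [0..<Suc n] = cobd n (cup J P Q (n - 1) a b) \<sigma>"
  proof (cases n)
    case 0
    then show ?thesis
      using P by (simp add: cobd_def list_cochain_def)
  next
    case (Suc n')
    have "diag False (map (skip k) [0..<n]) J (?G \<sigma>) = cup J P Q n' a b (singular_face n k \<sigma>)" for k
      unfolding cup_def diag_map Suc
    proof (rule diag_cong)
      have *: "list_cochain R c (singular_face (Suc n') k \<sigma>) A = list_cochain R c \<sigma> (map (skip k) A)"
        if "set A \<subseteq> set [0..<Suc n']" "R \<ge> 1" for R A and c :: "'a cochain"
      proof (cases "length A = R")
        case True
        have "set A \<subseteq> {..n'}" "A \<noteq> []"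
          using that True by auto
        then show ?thesis
          by (simp add: list_cochain_def list_face_singular_face)
      qed (simp add: list_cochain_def)
      show "?G \<sigma> (map (skip k) A) (map (skip k) B) = ?G (singular_face (Suc n') k \<sigma>) A B"
        if "set A \<subseteq> set [0..<Suc n']" "set B \<subseteq> set [0..<Suc n']" for A B
        using *[OF that(1) P] *[OF that(2) Q] by simp
    qed
    then show ?thesis
      unfolding list_bd_upt by (simp add: cobd_def Suc)
  qed
  finally show ?thesis
    by (simp add: algebra_simps)
qed

subsection \<open>Comparison with the definition of the cup-i products\<close>

text \<open>The shift \<open>t\<close> compensates for removing the least element of
  \<open>U\<close>, which lowers all other ranks by one. It makes an induction on the least vertex
  possible.\<close>

definition index_part :: "bool \<Rightarrow> nat \<Rightarrow> nat set \<Rightarrow> nat set" where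
  "index_part b t U = {u \<in> U. even (u + t + card {w \<in> U. w \<le> u}) = b}"

lemma index_even_eq: "index_even U = index_part True 0 U"
  and index_odd_eq: "index_odd U = index_part False 0 U"
  by (simp_all add: index_even_def index_odd_def index_part_def)

lemma sorted_list_of_set_insert_less:
  fixes m :: "'b::linorder"
  assumes "finite S" "\<And>x. x \<in> S \<Longrightarrow> m < x"
  shows "sorted_list_of_set (insert m S) = m # sorted_list_of_set S"
proof -
  have "m \<notin> S"
    using assms(2) by blast
  then show ?thesis
    using assms by (auto intro!: insort_is_Cons simp: less_imp_le)
qed

lemma index_part_insert_less:
  assumes "finite U" and U: "\<And>x. x \<in> U \<Longrightarrow> m < x"
  shows "index_part b t (insert m U) = (if odd (m + t) = b then {m} else {}) \<union> index_part b (Suc t) U"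
proof -
  have m: "m \<notin> U" "{w \<in> insert m U. w \<le> m} = {m}"
    using U by force+
  have card: "card {w \<in> insert m U. w \<le> u} = Suc (card {w \<in> U. w \<le> u})" if "u \<in> U" for u
  proof -
    have "{w \<in> insert m U. w \<le> u} = insert m {w \<in> U. w \<le> u}"
      using U[OF that] by auto
    then show ?thesis
      using m(1) assms(1) by simp
  qed
  show ?thesis
  proof (rule Set.set_eqI)
    fix u
    consider "u = m" | "u \<in> U" | "u \<noteq> m" "u \<notin> U"
      by blast
    then show "u \<in> index_part b t (insert m U) \<longleftrightarrow>
        u \<in> (if odd (m + t) = b then {m} else {}) \<union> index_part b (Suc t) U"
    proof cases
      case 1
      then show ?thesis
        using m by (cases "odd (m + t)"; cases b) (simp_all add: index_part_def)
    next
      case 2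
      then have "u \<noteq> m"
        using m by blast
      then show ?thesis
        using 2 card[OF 2] by (simp add: index_part_def)
    qed (simp add: index_part_def)
  qed
qed

text \<open>\<open>U\<close> is the set of vertices that lie in one factor only. Moving past a
  vertex of \<open>U\<close> raises both the position and the rank in \<open>U\<close> and keeps the
  parity of their sum; moving past a shared vertex raises only the position and changes it. So this
  parity is the state of the automaton \<open>diag\<close>.\<close>

lemma diag_eq_sum:
  "diag (odd (m + t)) [m..<m + d] j G =
   (\<Sum>U | U \<subseteq> {m..<m + d} \<and> card U + j = d.
      G (sorted_list_of_set ({m..<m + d} - index_part True t U))
        (sorted_list_of_set ({m..<m + d} - index_part False t U)))"
proof (induction d arbitrary: m t j G)
  case 0
  have "{U. U \<subseteq> {m..<m + 0} \<and> card U + j = 0} = (if j = 0 then {{}} else {})"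
    by auto
  then show ?case
    by (simp add: index_part_def)
next
  case (Suc d)
  define I where "I = {Suc m..<Suc m + d}"
  define L where "L b t U = sorted_list_of_set (I - index_part b t U)" for b t U
  have I: "{m..<m + Suc d} = insert m I" "finite I" "m \<notin> I" "\<And>x. x \<in> I \<Longrightarrow> m < x"
    by (auto simp: I_def)
  have finU: "finite U" if "U \<subseteq> I" for U
    using that I(2) finite_subset by blast
  have key: "sorted_list_of_set (insert m (I - D)) = m # sorted_list_of_set (I - D)" for D
    using I by (intro sorted_list_of_set_insert_less) auto
  let ?s = "odd (m + t)"
  let ?F = "\<lambda>U. G (sorted_list_of_set (insert m I - index_part True t U))
                  (sorted_list_of_set (insert m I - index_part False t U))"
  let ?A = "{U. U \<subseteq> I \<and> card U + j = d}"
  let ?B = "{U. U \<subseteq> I \<and> card U + j = Suc d}"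
  \<comment> \<open>Peel off the least vertex \<open>m\<close>: either it belongs to
    \<open>U\<close>, and then \<open>t\<close> advances, or it is shared, and then \<open>j\<close>
    drops by one.\<close>
  have split: "{U. U \<subseteq> insert m I \<and> card U + j = Suc d} = insert m ` ?A \<union> ?B"
  proof (intro subset_antisym subsetI)
    fix U assume U: "U \<in> {U. U \<subseteq> insert m I \<and> card U + j = Suc d}"
    show "U \<in> insert m ` ?A \<union> ?B"
    proof (cases "m \<in> U")
      case True
      have "finite U"
        using U I(2) finite_subset by blast
      then have "card U = Suc (card (U - {m}))"
        using True by (metis card_Suc_Diff1)
      then have "U - {m} \<in> ?A" "U = insert m (U - {m})"
        using U True by auto
      then show ?thesis by blast
    next
      case False
      then show ?thesis using U by auto
    qed
  next
    fix U assume "U \<in> insert m ` ?A \<union> ?B"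
    then show "U \<in> {U. U \<subseteq> insert m I \<and> card U + j = Suc d}"
    proof
      assume "U \<in> insert m ` ?A"
      then obtain U' where U': "U = insert m U'" "U' \<subseteq> I" "card U' + j = d"
        by auto
      moreover have "m \<notin> U'" "finite U'"
        using U'(2) I(3) finU by auto
      ultimately show ?thesis by auto
    qed auto
  qed
  have disj: "insert m ` ?A \<inter> ?B = {}"
    using I(3) by auto
  have fin: "finite ?A" "finite ?B"
    using I(2) by auto
  have inj: "inj_on (insert m) ?A"
    using I(3) by (auto simp: inj_on_def dest: insert_ident[THEN iffD1, rotated 2])
  have F1: "?F (insert m U) = (if ?s then G (L True (Suc t) U) (m # L False (Suc t) U)
      else G (m # L True (Suc t) U) (L False (Suc t) U))" if U: "U \<subseteq> I" for U
  proof -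
    have *: "sorted_list_of_set (insert m I - index_part b t (insert m U)) =
        (if odd (m + t) = b then L b (Suc t) U else m # L b (Suc t) U)" for b
    proof -
      have "index_part b t (insert m U) = (if odd (m + t) = b then {m} else {}) \<union> index_part b (Suc t) U"
        using U I finU by (intro index_part_insert_less) auto
      moreover have "m \<notin> index_part b (Suc t) U"
        using U I(3) by (auto simp: index_part_def)
      ultimately have "insert m I - index_part b t (insert m U) =
          (if odd (m + t) = b then I - index_part b (Suc t) U else insert m (I - index_part b (Suc t) U))"
        using I(3) by (cases "odd (m + t) = b") auto
      then show ?thesis
        by (simp only: L_def key if_distrib[of sorted_list_of_set])
    qed
    show ?thesis
      unfolding * by auto
  qed
  have F2: "?F U = G (m # L True t U) (m # L False t U)" if U: "U \<subseteq> I" for U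
  proof -
    have "sorted_list_of_set (insert m I - index_part b t U) = m # L b t U" for b
    proof -
      have "insert m I - index_part b t U = insert m (I - index_part b t U)"
        using U I(3) by (auto simp: index_part_def)
      then show ?thesis
        by (simp only: L_def key if_distrib[of sorted_list_of_set])
    qed
    then show ?thesis by simp
  qed
  have upt: "[m..<m + Suc d] = m # [Suc m..<Suc m + d]"
    by (subst upt_conv_Cons) auto
  have "(\<Sum>U | U \<subseteq> insert m I \<and> card U + j = Suc d. ?F U) = sum ?F (insert m ` ?A) + sum ?F ?B"
    unfolding split using fin disj by (intro sum.union_disjoint) auto
  also have "sum ?F (insert m ` ?A) = (\<Sum>U\<in>?A. if ?s then G (L True (Suc t) U) (m # L False (Suc t) U)
      else G (m # L True (Suc t) U) (L False (Suc t) U))"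
    unfolding sum.reindex[OF inj] o_def by (intro sum.cong refl F1) auto
  also have "\<dots> = diag ?s [Suc m..<Suc m + d] j
      (if ?s then (\<lambda>A B. G A (m # B)) else (\<lambda>A B. G (m # A) B))"
  proof -
    have s: "odd (Suc m + Suc t) = ?s"
      by simp
    show ?thesis
      using Suc.IH[of "Suc m" "Suc t" j "\<lambda>A B. G A (m # B)"] Suc.IH[of "Suc m" "Suc t" j "\<lambda>A B. G (m # A) B"]
      unfolding s L_def[symmetric] I_def[symmetric] by (cases ?s) (simp_all only: if_True if_False not_False_eq_True)
  qed
  also have "sum ?F ?B = (if j = 0 then 0 else diag (\<not> ?s) [Suc m..<Suc m + d] (j - 1) (\<lambda>A B. G (m # A) (m # B)))"
  proof (cases j)
    case 0
    have "card U + j \<noteq> Suc d" if "U \<subseteq> I" for U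
      using card_mono[OF I(2) that] 0 by (simp add: I_def)
    then have "?B = {}"
      by blast
    then show ?thesis
      unfolding \<open>?B = {}\<close> using 0 by simp
  next
    case (Suc j')
    have "sum ?F ?B = (\<Sum>U | U \<subseteq> I \<and> card U + j' = d. G (m # L True t U) (m # L False t U))"
      using Suc by (intro sum.cong F2) auto
    then show ?thesis
      using Suc.IH[of "Suc m" t j' "\<lambda>A B. G (m # A) (m # B)"] Suc by (simp add: L_def I_def)
  qed
  finally show ?case
    unfolding I(1) upt by simp
qed

lemma bary_sorted_list_of_set:
  assumes "finite W"
  shows "bary (sorted_list_of_set W) t v = (if v \<in> W then t (card {w \<in> W. w < v}) else 0)"
proof (cases "v \<in> W")
  case True
  define l where "l = sorted_list_of_set W"
  have l: "set l = W" "distinct l" "sorted l"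
    using assms by (simp_all add: l_def)
  then obtain j where j: "j < length l" "l ! j = v"
    using True by (metis in_set_conv_nth)
  have "{w \<in> W. w < v} = (!) l ` {..<j}"
  proof (intro subset_antisym subsetI)
    fix w assume "w \<in> {w \<in> W. w < v}"
    then obtain k where k: "k < length l" "l ! k = w" "w < v"
      using l by (auto simp: in_set_conv_nth)
    then have "k < j"
      using l(3) j by (metis linorder_not_le sorted_nth_mono)
    then show "w \<in> (!) l ` {..<j}"
      using k by auto
  next
    fix w assume "w \<in> (!) l ` {..<j}"
    then obtain k where k: "k < j" "w = l ! k"
      by auto
    then have "l ! k \<le> l ! j" "l ! k \<noteq> l ! j"
      using l j by (auto simp: sorted_nth_mono nth_eq_iff_index_eq)
    then show "w \<in> {w \<in> W. w < v}"
      using k j l by auto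
  qed
  moreover have "inj_on ((!) l) {..<j}"
    using l j by (auto simp: inj_on_def nth_eq_iff_index_eq)
  ultimately have c: "card {w \<in> W. w < v} = j"
    by (simp add: card_image)
  have "bary l t v = (\<Sum>k<length l. if k = j then t k else 0)"
    unfolding bary_def using l j by (intro sum.cong) (auto simp: nth_eq_iff_index_eq)
  also have "\<dots> = t j"
    using j by simp
  finally show ?thesis
    using True c by (simp add: l_def)
qed (use assms in \<open>simp add: bary_eq_0\<close>)

lemma vertex_face_eq_list_face:
  assumes "finite W" "card W = Suc m"
  shows "vertex_face m W \<sigma> = list_face (sorted_list_of_set W) \<sigma>"
proof -
  have "bary (sorted_list_of_set W) = (\<lambda>t v. if v \<in> W then t (card {w \<in> W. w < v}) else 0)"
    using bary_sorted_list_of_set[OF assms(1)] by (simp add: fun_eq_iff)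
  then show ?thesis
    using assms by (simp add: vertex_face_def list_face_def)
qed

text \<open>A set \<open>U\<close> of \<open>n - i\<close> vertices leaves \<open>i + 1\<close>
  shared ones, whence the index \<open>Suc i\<close>. The terms excluded by the cardinality
  conditions are zero by the length test in \<open>list_cochain\<close>.\<close>

lemma cup_i_eq_cup:
  assumes "singular_simplex n X \<sigma>" "n + i = p + q"
  shows "cup_i i p q X a b \<sigma> = cup (Suc i) (Suc p) (Suc q) n a b \<sigma>"
proof -
  let ?T = "\<lambda>U. list_cochain (Suc p) a \<sigma> (sorted_list_of_set ({..n} - index_even U)) *
                list_cochain (Suc q) b \<sigma> (sorted_list_of_set ({..n} - index_odd U))"
  have n: "p + q - i = n"
    using assms(2) by simp
  have card: "card ({..n} - D) = Suc r \<longleftrightarrow> card D + r = n" if "D \<subseteq> {..n}" for D r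
  proof -
    have "card D \<le> Suc n" "finite D"
      using that card_mono[OF _ that] finite_subset by auto
    then show ?thesis
      using that by (simp add: card_Diff_subset) linarith
  qed
  have sub: "index_even U \<subseteq> U" "index_odd U \<subseteq> U" for U
    by (auto simp: index_even_def index_odd_def)
  have "cup (Suc i) (Suc p) (Suc q) n a b \<sigma> = (\<Sum>U | U \<subseteq> {..n} \<and> card U + i = n. ?T U)"
    unfolding cup_def
    using diag_eq_sum[of 0 0 "Suc n" "Suc i" "\<lambda>A B. list_cochain (Suc p) a \<sigma> A * list_cochain (Suc q) b \<sigma> B"]
    by (simp add: index_even_eq index_odd_eq atLeast0LessThan lessThan_Suc_atMost del: upt_Suc)
  also have "\<dots> = (\<Sum>U | U \<subseteq> {..n} \<and> card U + i = n \<and> card (index_even U) + p = n \<and> card (index_odd U) + q = n. ?T U)"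
  proof (rule sum.mono_neutral_right)
    show "\<forall>U\<in>{U. U \<subseteq> {..n} \<and> card U + i = n} -
        {U. U \<subseteq> {..n} \<and> card U + i = n \<and> card (index_even U) + p = n \<and> card (index_odd U) + q = n}. ?T U = 0"
    proof
      fix U assume "U \<in> {U. U \<subseteq> {..n} \<and> card U + i = n} -
        {U. U \<subseteq> {..n} \<and> card U + i = n \<and> card (index_even U) + p = n \<and> card (index_odd U) + q = n}"
      then have "U \<subseteq> {..n}" "\<not> (card (index_even U) + p = n \<and> card (index_odd U) + q = n)"
        by auto
      moreover have "index_even U \<subseteq> {..n}" "index_odd U \<subseteq> {..n}"
        using sub \<open>U \<subseteq> {..n}\<close> by blast+
      ultimately show "?T U = 0"
        using card[of "index_even U" p] card[of "index_odd U" q] by (auto simp: list_cochain_def)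
    qed
  qed auto
  also have "\<dots> = cup_i i p q X a b \<sigma>"
  proof -
    have "?T U = a (vertex_face p ({..n} - index_even U) \<sigma>) * b (vertex_face q ({..n} - index_odd U) \<sigma>)"
      if "U \<subseteq> {..n}" "card (index_even U) + p = n" "card (index_odd U) + q = n" for U
    proof -
      have "index_even U \<subseteq> {..n}" "index_odd U \<subseteq> {..n}"
        using sub that(1) by blast+
      then show ?thesis
        using card[of "index_even U" p] card[of "index_odd U" q] that
        by (simp add: list_cochain_def vertex_face_eq_list_face)
    qed
    then show ?thesis
      using assms(1) unfolding cup_i_def n Let_def by (auto intro!: sum.cong)
  qed
  finally show ?thesis ..
qed

subsection \<open>Evaluation of cochains on chains\<close>

text \<open>The mod 2 pairing with integral chains; \<open>of_int\<close> reduces the coefficients.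
  It makes the integral subdivision operators available for mod 2 cochains.\<close>

definition eval_chain :: "'a cochain \<Rightarrow> 'a chain \<Rightarrow> bit" where
  "eval_chain \<phi> c = (\<Sum>\<sigma>\<in>Poly_Mapping.keys c. of_int (Poly_Mapping.lookup c \<sigma>) * \<phi> \<sigma>)"

lemma eval_chain_superset:
  assumes "finite S" "Poly_Mapping.keys c \<subseteq> S"
  shows "eval_chain \<phi> c = (\<Sum>\<sigma>\<in>S. of_int (Poly_Mapping.lookup c \<sigma>) * \<phi> \<sigma>)"
  unfolding eval_chain_def using assms
  by (intro sum.mono_neutral_left) (auto simp: in_keys_iff)

lemma eval_chain_0 [simp]: "eval_chain \<phi> 0 = 0"
  by (simp add: eval_chain_def)

lemma eval_chain_of [simp]: "eval_chain \<phi> (frag_of \<sigma>) = \<phi> \<sigma>"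
  by (simp add: eval_chain_def)

lemma eval_chain_add: "eval_chain \<phi> (c + d) = eval_chain \<phi> c + eval_chain \<phi> d"
proof -
  let ?S = "Poly_Mapping.keys c \<union> Poly_Mapping.keys d"
  have "Poly_Mapping.keys (c + d) \<subseteq> ?S"
    by (rule keys_add)
  then show ?thesis
    by (simp add: eval_chain_superset[of ?S] lookup_add distrib_right sum.distrib)
qed

lemma eval_chain_minus: "eval_chain \<phi> (- c) = eval_chain \<phi> c"
  using eval_chain_add[of \<phi> c "- c"] by (simp add: bit_add_eq_0_iff)

lemma eval_chain_diff: "eval_chain \<phi> (c - d) = eval_chain \<phi> c + eval_chain \<phi> d"
  using eval_chain_add[of \<phi> c "- d"] by (simp add: eval_chain_minus)

lemma eval_chain_sum: "eval_chain \<phi> (sum f I) = (\<Sum>i\<in>I. eval_chain \<phi> (f i))"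
  by (induction I rule: infinite_finite_induct) (simp_all add: eval_chain_add)

lemma eval_chain_sign: "eval_chain \<phi> (frag_cmul ((-1) ^ k) c) = eval_chain \<phi> c"
  by (cases "even k") (simp_all add: eval_chain_minus)

lemma eval_chain_extend:
  "eval_chain \<phi> (frag_extend f c) = eval_chain (\<lambda>\<sigma>. eval_chain \<phi> (f \<sigma>)) c"
  using subset_UNIV
  by (induction c rule: frag_induction) (simp_all add: frag_extend_diff eval_chain_diff)

lemma eval_chain_chain_map:
  "eval_chain \<phi> (chain_map n g c) = eval_chain (\<lambda>\<sigma>. \<phi> (simplex_map n g \<sigma>)) c"
  by (simp add: chain_map_def eval_chain_extend)

lemma eval_chain_boundary: "eval_chain \<phi> (chain_boundary n c) = eval_chain (cobd n \<phi>) c"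
  by (simp add: chain_boundary_def eval_chain_extend eval_chain_sum eval_chain_sign cobd_def[abs_def])
     (simp add: eval_chain_def)

lemma eval_chain_cong:
  assumes "singular_chain n X c" "\<And>\<sigma>. singular_simplex n X \<sigma> \<Longrightarrow> \<phi> \<sigma> = \<psi> \<sigma>"
  shows "eval_chain \<phi> c = eval_chain \<psi> c"
  unfolding eval_chain_def using assms by (intro sum.cong) (auto simp: singular_chain_def)

lemma eval_chain_add_left:
  "eval_chain (\<lambda>\<sigma>. \<phi> \<sigma> + \<psi> \<sigma>) c = eval_chain \<phi> c + eval_chain \<psi> c"
  by (simp add: eval_chain_def distrib_left sum.distrib)

lemma cobd_eq_eval_chain: "cobd n \<phi> \<sigma> = eval_chain \<phi> (chain_boundary n (frag_of \<sigma>))"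
  by (simp add: eval_chain_boundary)

lemma cobd_add: "cobd n (\<lambda>\<sigma>. \<phi> \<sigma> + \<psi> \<sigma>) \<sigma> = cobd n \<phi> \<sigma> + cobd n \<psi> \<sigma>"
  by (simp add: cobd_def sum.distrib)

lemma cobd_zero [simp]: "cobd n (\<lambda>\<sigma>. 0) \<sigma> = 0"
  by (simp add: cobd_def)

lemma cobd_cobd:
  assumes "singular_simplex (Suc n) X \<sigma>"
  shows "cobd (Suc n) (cobd n \<phi>) \<sigma> = 0"
  using assms chain_boundary_boundary[of "Suc n" X "frag_of \<sigma>"]
  by (simp add: cobd_eq_eval_chain[of "Suc n"] eval_chain_boundary[symmetric] singular_chain_of)

lemma cobd_cong:
  assumes "singular_simplex n X \<sigma>" "\<And>\<tau>. singular_simplex (n - 1) X \<tau> \<Longrightarrow> \<phi> \<tau> = \<psi> \<tau>"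
  shows "cobd n \<phi> \<sigma> = cobd n \<psi> \<sigma>"
  using assms(1) by (cases "n = 0") (auto simp: cobd_def intro!: sum.cong assms(2)[simplified] singular_simplex_singular_face)

lemma singular_face_simplex_map':
  assumes "1 \<le> n" "k \<le> n"
  shows "singular_face n k (simplex_map n f \<sigma>) = simplex_map (n - 1) f (singular_face n k \<sigma>)"
  using assms unfolding singular_face_simplex_map[OF assms]
  by (auto simp: singular_face_def simplex_map_def)

lemma cobd_simplex_map:
  "cobd n \<phi> (simplex_map n f \<sigma>) = cobd n (\<lambda>\<tau>. \<phi> (simplex_map (n - 1) f \<tau>)) \<sigma>"
  by (simp add: cobd_def singular_face_simplex_map' Suc_le_eq)

subsection \<open>A natural chain homotopy for barycentric subdivision\<close>

text \<open>The affine homotopy \<open>subd\<close> of the identity simplex, pushed forward along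
  each singular simplex. This makes it natural by construction; naturality for \<open>flip\<close>
  is what makes the homotopy equivariant.\<close>

definition sd_homotopy :: "nat \<Rightarrow> 'a chain \<Rightarrow> 'a chain" where
  "sd_homotopy p =
     frag_extend (\<lambda>f. chain_map (Suc p) f (subd p (frag_of (restrict id (standard_simplex p)))))"

lemma sd_homotopy_0 [simp]: "sd_homotopy p 0 = 0"
  by (simp add: sd_homotopy_def)

lemma sd_homotopy_diff: "sd_homotopy p (c - d) = sd_homotopy p c - sd_homotopy p d"
  by (simp add: sd_homotopy_def frag_extend_diff)

lemma simplicial_chain_subd_id:
  "simplicial_chain (Suc p) (standard_simplex p) (subd p (frag_of (restrict id (standard_simplex p))))"
  by (simp add: subd)

lemma chain_map_simplex_map:
  assumes "simplicial_chain q (standard_simplex p) d"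
  shows "chain_map q (simplex_map p g f) d = chain_map q g (chain_map q f d)"
  using assms unfolding simplicial_chain_def
proof (induction d rule: frag_induction)
  case (one x)
  then have "x ` standard_simplex q \<subseteq> standard_simplex p"
    by (simp add: simplicial_simplex)
  then have "simplex_map q (simplex_map p g f) x = simplex_map q g (simplex_map q f x)"
    by (auto simp: simplex_map_def fun_eq_iff)
  then show ?case by simp
qed (auto simp: chain_map_diff)

lemma sd_homotopy_chain_map:
  "sd_homotopy p (chain_map p g c) = chain_map (Suc p) g (sd_homotopy p c)"
  using subset_UNIV
proof (induction c rule: frag_induction)
  case (one f)
  then show ?case
    by (simp add: sd_homotopy_def chain_map_simplex_map[OF simplicial_chain_subd_id])
qed (auto simp: chain_map_diff sd_homotopy_diff)

text \<open>Needed for the boundary of the identity simplex, where the homotopy formula for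
  \<open>subd\<close> has to be turned into one for \<open>sd_homotopy\<close>.\<close>

lemma sd_homotopy_simplicial:
  assumes "simplicial_chain p (standard_simplex s) c"
  shows "sd_homotopy p c = subd p c"
  using assms unfolding simplicial_chain_def
proof (induction c rule: frag_induction)
  case (one f)
  then have f: "simplicial_simplex p (standard_simplex s) f"
    by simp
  then have "singular_simplex p (subtopology (powertop_real UNIV) (standard_simplex s)) f"
    by (simp add: simplicial_simplex_def)
  then have "chain_map p f (frag_of (restrict id (standard_simplex p))) = frag_of f"
    by (rule singular_simplex_chain_map_id)
  moreover have "chain_map (Suc p) f (subd p (frag_of (restrict id (standard_simplex p)))) =
      subd p (chain_map p f (frag_of (restrict id (standard_simplex p))))"
    by (rule chain_homotopic_simplicial_subdivision1[OF _ f]) simp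
  ultimately show ?case
    by (simp add: sd_homotopy_def)
qed (auto simp: sd_homotopy_diff)

lemma singular_chain_sd_homotopy:
  assumes "singular_chain p X c"
  shows "singular_chain (Suc p) X (sd_homotopy p c)"
  unfolding sd_homotopy_def
proof (rule singular_chain_extend)
  fix f assume "f \<in> Poly_Mapping.keys c"
  then have "continuous_map (subtopology (powertop_real UNIV) (standard_simplex p)) X f"
    using assms by (auto simp: singular_chain_def singular_simplex_def)
  with simplicial_imp_singular_chain[OF simplicial_chain_subd_id[of p]]
  show "singular_chain (Suc p) X (chain_map (Suc p) f (subd p (frag_of (restrict id (standard_simplex p)))))"
    by (rule singular_chain_chain_map)
qed

text \<open>On the identity simplex this is the homotopy formula for \<open>subd\<close>; pushing it
  forward along \<open>f\<close> gives the formula for \<open>f\<close>.\<close>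

lemma chain_boundary_sd_homotopy:
  assumes "singular_chain p X c"
  shows "chain_boundary (Suc p) (sd_homotopy p c) + sd_homotopy (p - 1) (chain_boundary p c) =
    singular_subdivision p c - c"
  using assms unfolding singular_chain_def
proof (induction c rule: frag_induction)
  case (one f)
  let ?i = "frag_of (restrict id (standard_simplex p))"
  let ?P = "subtopology (powertop_real UNIV) (standard_simplex p)"
  have i: "simplicial_chain p (standard_simplex p) ?i"
    by simp
  have f: "singular_simplex p X f"
    using one by simp
  have fi: "chain_map p f ?i = frag_of f"
    by (rule singular_simplex_chain_map_id[OF f])
  have bi: "simplicial_chain (p - 1) (standard_simplex p) (chain_boundary p ?i)"
    using simplicial_chain_boundary[OF i] by simp
  have "chain_boundary (Suc p) (sd_homotopy p (frag_of f)) =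
      chain_map p f (chain_boundary (Suc p) (subd p ?i))"
    using chain_boundary_chain_map[OF simplicial_imp_singular_chain[OF simplicial_chain_subd_id[of p]], of f]
    by (simp add: sd_homotopy_def)
  also have "\<dots> = chain_map p f (simplicial_subdivision p ?i - ?i - subd (p - 1) (chain_boundary p ?i))"
    using chain_homotopic_simplicial_subdivision3[OF i] by simp
  also have "\<dots> = singular_subdivision p (frag_of f) - frag_of f
      - chain_map p f (subd (p - 1) (chain_boundary p ?i))"
    unfolding chain_map_diff fi by (simp add: singular_subdivision_def)
  also have "chain_map p f (subd (p - 1) (chain_boundary p ?i)) = sd_homotopy (p - 1) (chain_boundary p (frag_of f))"
  proof (cases "p = 0")
    case True
    then show ?thesis by (simp add: chain_boundary_def)
  next
    case False
    have "chain_map p f (subd (p - 1) (chain_boundary p ?i)) =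
        chain_map (Suc (p - 1)) f (sd_homotopy (p - 1) (chain_boundary p ?i))"
      using False by (simp add: sd_homotopy_simplicial[OF bi] del: One_nat_def)
    also have "\<dots> = sd_homotopy (p - 1) (chain_map (p - 1) f (chain_boundary p ?i))"
      by (simp add: sd_homotopy_chain_map)
    also have "chain_map (p - 1) f (chain_boundary p ?i) = chain_boundary p (frag_of f)"
      using chain_boundary_chain_map[OF simplicial_imp_singular_chain[OF i], of f] fi by simp
    finally show ?thesis .
  qed
  finally show ?case by simp
next
  case (diff a b)
  have "chain_boundary (Suc p) (sd_homotopy p (a - b)) + sd_homotopy (p - 1) (chain_boundary p (a - b)) =
     (chain_boundary (Suc p) (sd_homotopy p a) + sd_homotopy (p - 1) (chain_boundary p a)) -
     (chain_boundary (Suc p) (sd_homotopy p b) + sd_homotopy (p - 1) (chain_boundary p b))"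
    unfolding chain_boundary_diff sd_homotopy_diff by (rule add_diff_add[symmetric])
  also have "\<dots> = (singular_subdivision p a - a) - (singular_subdivision p b - b)"
    unfolding diff ..
  also have "\<dots> = singular_subdivision p (a - b) - (a - b)"
    unfolding singular_subdivision_diff by (simp add: algebra_simps)
  finally show ?case .
qed auto

subsection \<open>Cochains that vanish on cycles\<close>

lemma poly_mapping_bit_add_self: "(x :: 'b \<Rightarrow>\<^sub>0 bit) + x = 0"
  by (rule poly_mapping_eqI) (simp add: lookup_add)

text \<open>The only scalar multiplication by the field of two elements, spelled out so that
  abstract linear algebra applies.\<close>

definition bit_scale :: "bit \<Rightarrow> ('b \<Rightarrow>\<^sub>0 bit) \<Rightarrow> 'b \<Rightarrow>\<^sub>0 bit" where
  "bit_scale c x = (if c = 0 then 0 else x)"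

lemma vector_space_bit_scale: "vector_space bit_scale"
proof
  fix a b :: bit and x y :: "'b \<Rightarrow>\<^sub>0 bit"
  show "bit_scale a (x + y) = bit_scale a x + bit_scale a y"
    by (simp add: bit_scale_def)
  show "bit_scale (a + b) x = bit_scale a x + bit_scale b x"
    by (cases a; cases b) (simp_all add: bit_scale_def poly_mapping_bit_add_self)
  show "bit_scale a (bit_scale b x) = bit_scale (a * b) x"
    by (cases a; cases b) (simp_all add: bit_scale_def)
  show "bit_scale 1 x = x"
    by (simp add: bit_scale_def)
qed

lemma bit_poly_mapping_sum_superset:
  fixes h :: "'b \<Rightarrow> 'c::comm_monoid_add"
  assumes "finite S" "Poly_Mapping.keys x \<subseteq> S"
  shows "sum h (Poly_Mapping.keys x) = (\<Sum>s\<in>S. if Poly_Mapping.lookup x s = (1::bit) then h s else 0)"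
  using assms by (intro sum.mono_neutral_cong_left) (auto simp: in_keys_iff)

lemma bit_poly_mapping_sum_add:
  fixes h :: "'b \<Rightarrow> 'c::comm_monoid_add" and x y :: "'b \<Rightarrow>\<^sub>0 bit"
  assumes "\<And>s. h s + h s = 0"
  shows "sum h (Poly_Mapping.keys (x + y)) = sum h (Poly_Mapping.keys x) + sum h (Poly_Mapping.keys y)"
proof -
  let ?S = "Poly_Mapping.keys x \<union> Poly_Mapping.keys y"
  have *: "Poly_Mapping.keys (x + y) \<subseteq> ?S"
    by (rule keys_add)
  have "(if a + b = 1 then h s else 0) = (if a = 1 then h s else 0) + (if b = 1 then h s else 0)"
    for a b :: bit and s
    by (cases a; cases b) (simp_all add: assms)
  with * show ?thesis
    by (simp add: bit_poly_mapping_sum_superset[of ?S] lookup_add flip: sum.distrib)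
qed

text \<open>The case \<open>n = 0\<close> is included: there \<open>cobd 0 = 0\<close> and every chain is a cycle.\<close>

lemma cochain_eq_cobd_if_vanishes_on_cycles:
  fixes f :: "'a cochain"
  assumes "\<And>S. \<lbrakk>finite S; \<And>\<sigma>. \<sigma> \<in> S \<Longrightarrow> singular_simplex n Y \<sigma>; \<And>\<phi>. (\<Sum>\<sigma>\<in>S. cobd n \<phi> \<sigma>) = 0\<rbrakk>
     \<Longrightarrow> (\<Sum>\<sigma>\<in>S. f \<sigma>) = 0"
  shows "\<exists>g. \<forall>\<sigma>. singular_simplex n Y \<sigma> \<longrightarrow> f \<sigma> = cobd n g \<sigma>"
proof -
  define single :: "((nat \<Rightarrow> real) \<Rightarrow> 'a) \<Rightarrow> _ \<Rightarrow>\<^sub>0 bit" where "single \<sigma> = Poly_Mapping.single \<sigma> 1" for \<sigma>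
  define ev where "ev \<phi> x = sum \<phi> (Poly_Mapping.keys x)"
    for \<phi> :: "'a cochain" and x :: "((nat \<Rightarrow> real) \<Rightarrow> 'a) \<Rightarrow>\<^sub>0 bit"
  define d where "d \<sigma> = (if singular_simplex n Y \<sigma> \<and> n \<noteq> 0 then \<Sum>k\<le>n. single (singular_face n k \<sigma>) else 0)" for \<sigma>
  define D where "D x = sum d (Poly_Mapping.keys x)" for x :: "((nat \<Rightarrow> real) \<Rightarrow> 'a) \<Rightarrow>\<^sub>0 bit"
  define f' where "f' \<sigma> = (if singular_simplex n Y \<sigma> then f \<sigma> else 0)" for \<sigma>
  have ev_add: "ev \<phi> (x + y) = ev \<phi> x + ev \<phi> y" for \<phi> x y
    unfolding ev_def by (rule bit_poly_mapping_sum_add) simp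
  have D_add: "D (x + y) = D x + D y" for x y
    unfolding D_def by (rule bit_poly_mapping_sum_add) (rule poly_mapping_bit_add_self)
  have ev_single: "ev \<phi> (single \<sigma>) = \<phi> \<sigma>" for \<phi> \<sigma>
    by (simp add: ev_def single_def)
  have D_single: "D (single \<sigma>) = d \<sigma>" for \<sigma>
    by (simp add: D_def single_def)
  have ev_0: "ev \<phi> 0 = 0" and D_0: "D 0 = 0" for \<phi>
    by (simp_all add: ev_def D_def)
  have ev_sum: "ev \<phi> (sum h I) = (\<Sum>i\<in>I. ev \<phi> (h i))" for \<phi> h and I :: "'i set"
    by (induction I rule: infinite_finite_induct) (simp_all add: ev_add ev_0)
  have ev_d: "ev \<phi> (d \<sigma>) = (if singular_simplex n Y \<sigma> then cobd n \<phi> \<sigma> else 0)" for \<phi> \<sigma>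
    by (simp add: d_def ev_sum ev_single ev_0 cobd_def)
  have cyc: "ev f' x = 0" if "D x = 0" for x
  proof -
    let ?S = "{\<sigma> \<in> Poly_Mapping.keys x. singular_simplex n Y \<sigma>}"
    have "(\<Sum>\<sigma>\<in>?S. cobd n \<phi> \<sigma>) = 0" for \<phi>
    proof -
      have "(\<Sum>\<sigma>\<in>?S. cobd n \<phi> \<sigma>) = (\<Sum>\<sigma>\<in>Poly_Mapping.keys x. ev \<phi> (d \<sigma>))"
        unfolding ev_d by (intro sum.mono_neutral_cong_left) auto
      also have "\<dots> = ev \<phi> (D x)"
        by (simp add: D_def ev_sum)
      finally show ?thesis
        using that by (simp add: ev_0)
    qed
    then have "(\<Sum>\<sigma>\<in>?S. f \<sigma>) = 0"
      by (intro assms) auto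
    moreover have "ev f' x = (\<Sum>\<sigma>\<in>?S. f \<sigma>)"
      unfolding ev_def f'_def by (intro sum.mono_neutral_cong_right) auto
    ultimately show ?thesis by simp
  qed
  interpret vector_space_pair bit_scale bit_scale
    by (intro vector_space_pair.intro vector_space_bit_scale)
  have "Vector_Spaces.linear bit_scale bit_scale D"
    unfolding Vector_Spaces.linear_iff using vector_space_bit_scale
    by (auto simp: D_add D_0 bit_scale_def)
  \<comment> \<open>\<open>R\<close> is linear and is a section of the boundary map over its image.
    Composing \<open>f'\<close> with \<open>R\<close> gives the required cochain:
    \<open>R (d \<sigma>) + single \<sigma>\<close> is a cycle, so \<open>f'\<close> takes the same
    value on its two summands.\<close>
  then obtain R where lin: "Vector_Spaces.linear bit_scale bit_scale R" and R: "\<And>v. v \<in> range D \<Longrightarrow> D (R v) = v"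
    using linear_exists_right_inverse_on[of D UNIV] vs1.subspace_UNIV by auto
  have R_add: "R (x + y) = R x + R y" for x y
    using lin unfolding Vector_Spaces.linear_iff by blast
  have R_0: "R 0 = 0"
    using R_add[of 0 0] by simp
  have R_sum: "R (sum h I) = (\<Sum>i\<in>I. R (h i))" for h and I :: "'i set"
    by (induction I rule: infinite_finite_induct) (simp_all add: R_add R_0)
  have "f \<sigma> = cobd n (\<lambda>\<tau>. ev f' (R (single \<tau>))) \<sigma>" if \<sigma>: "singular_simplex n Y \<sigma>" for \<sigma>
  proof -
    have "cobd n (\<lambda>\<tau>. ev f' (R (single \<tau>))) \<sigma> = ev f' (R (d \<sigma>))"
      using \<sigma> by (simp add: cobd_def d_def R_sum ev_sum R_0 ev_0)
    moreover have "D (R (d \<sigma>)) = d \<sigma>"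
      by (rule R) (metis D_single rangeI)
    then have "D (R (d \<sigma>) + single \<sigma>) = 0"
      by (simp add: D_add D_single poly_mapping_bit_add_self)
    then have "ev f' (R (d \<sigma>) + single \<sigma>) = 0"
      by (rule cyc)
    then have "ev f' (R (d \<sigma>)) = f' \<sigma>"
      by (simp add: ev_add ev_single bit_add_eq_0_iff)
    ultimately show ?thesis
      using \<sigma> by (simp add: f'_def)
  qed
  then show ?thesis
    by blast
qed

subsection \<open>Products with spheres\<close>

text \<open>Square roots of barycentric coordinates have squares with sum 1, so they map a simplex
  into an orthant of the sphere; \<open>N\<close> chooses the orthant. The entries of
  \<open>l\<close> are the vertices of a simplex in the product with the domain of
  \<open>\<tau>\<close>.\<close>

definition sphere_prism ::
    "nat set \<Rightarrow> ((nat \<Rightarrow> real) \<Rightarrow> 'a) \<Rightarrow> (nat \<times> nat) list \<Rightarrow> (nat \<Rightarrow> real) \<Rightarrow> (nat \<Rightarrow> real) \<times> 'a" where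
  "sphere_prism N \<tau> l = restrict
     (\<lambda>t. (\<lambda>x. (if x \<in> N then -1 else 1) * sqrt (bary (map fst l) t x), \<tau> (bary (map snd l) t)))
     (standard_simplex (length l - 1))"

lemma singular_face_sphere_prism:
  assumes "length l = Suc r" "1 \<le> r" "k \<le> r"
  shows "singular_face r k (sphere_prism N \<tau> l) = sphere_prism N \<tau> (take k l @ drop (Suc k) l)"
proof -
  have *: "bary (map f l) (simplical_face k t) = bary (map f (take k l) @ map f (drop (Suc k) l)) t"
    for f :: "nat \<times> nat \<Rightarrow> nat" and t
    using assms by (subst bary_simplical_face) (auto simp: take_map drop_map)
  show ?thesis
    using assms simplical_face_in_standard_simplex[of r k]
    by (auto simp: singular_face_def sphere_prism_def * intro!: restrict_ext)
qed

lemma sphere_prism_singular_face: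
  assumes "snd ` set l \<subseteq> {..m}" "l \<noteq> []"
  shows "sphere_prism N (singular_face (Suc m) k \<tau>) l = sphere_prism N \<tau> (map (map_prod id (skip k)) l)"
proof -
  have "bary (map snd l) t \<in> standard_simplex m" if "t \<in> standard_simplex (length l - 1)" for t
    using assms that by (intro bary_in_standard_simplex) auto
  then show ?thesis
    by (auto simp: singular_face_def sphere_prism_def fun_eq_iff simplical_face_bary o_def)
qed

lemma simplex_map_antipode_sphere_prism:
  assumes "length l = Suc r"
  shows "simplex_map r (map_prod antipode id) (sphere_prism N \<tau> l) = sphere_prism (- N) \<tau> l"
  using assms by (auto simp: simplex_map_def sphere_prism_def fun_eq_iff antipode_def)

lemma simplex_map_snd_sphere_prism:
  assumes "length l = Suc r"
  shows "simplex_map r snd (sphere_prism N \<tau> l) = list_face (map snd l) \<tau>"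
  using assms by (auto simp: simplex_map_def sphere_prism_def list_face_def fun_eq_iff)

text \<open>A coordinate whose vertex is absent from \<open>l\<close> is zero, so its sign makes no
  difference. This is how faces of simplices in different orthants are identified.\<close>

lemma sphere_prism_cong:
  assumes "\<And>x. x \<in> fst ` set l \<Longrightarrow> x \<in> N \<longleftrightarrow> x \<in> N'"
  shows "sphere_prism N \<tau> l = sphere_prism N' \<tau> l"
proof -
  have *: "(if x \<in> N then -1 else 1) * sqrt (bary (map fst l) t x) = (if x \<in> N' then -1 else 1) * sqrt (bary (map fst l) t x)" for t x
    using assms[of x] by (cases "x \<in> fst ` set l") (auto simp: bary_eq_0)
  show ?thesis
    unfolding sphere_prism_def * ..
qed

lemma singular_simplex_sphere_prism:
  assumes \<tau>: "singular_simplex m Y \<tau>" and l: "length l = Suc r" "set l \<subseteq> {..i} \<times> {..m}"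
  shows "singular_simplex r (prod_topology (nsphere i) Y) (sphere_prism N \<tau> l)"
proof -
  let ?D = "subtopology (powertop_real UNIV) (standard_simplex r)"
  let ?f = "\<lambda>t x. (if x \<in> N then -1 else 1) * sqrt (bary (map fst l) t x)"
  have "continuous_map ?D (nsphere i) ?f"
    unfolding nsphere continuous_map_in_subtopology
  proof (intro conjI image_subsetI Pi_I)
    show "continuous_map ?D (powertop_real UNIV) ?f"
      unfolding continuous_map_componentwise_UNIV
      by (intro allI continuous_map_real_mult continuous_map_sqrt continuous_map_bary_component) simp
    fix t assume "t \<in> topspace ?D"
    then have t: "t \<in> standard_simplex (length (map fst l) - 1)"
      using l by simp
    have "(\<Sum>x\<le>i. (?f t x)\<^sup>2) = (\<Sum>x\<le>i. bary (map fst l) t x)"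
      using bary_nonneg[OF t] by (intro sum.cong) (auto simp: power_mult_distrib)
    also have "\<dots> = 1"
      using l by (intro sum_bary[OF t]) auto
    finally have "(\<Sum>x\<le>i. (?f t x)\<^sup>2) = 1" .
    moreover have "bary (map fst l) t x = 0" if "x > i" for x
      using l(2) that by (intro bary_eq_0) fastforce
    ultimately show "?f t \<in> {x. (\<Sum>j\<le>i. (x j)\<^sup>2) = 1 \<and> (\<forall>j>i. x j = 0)}"
      by simp
  qed
  moreover have "singular_simplex r Y (list_face (map snd l) \<tau>)"
    using l by (intro singular_simplex_list_face[OF \<tau>]) auto
  then have "continuous_map ?D Y (list_face (map snd l) \<tau>)"
    by (simp add: singular_simplex_def)
  then have "continuous_map ?D Y (\<lambda>t. \<tau> (bary (map snd l) t))"
    by (rule continuous_map_eq) (use l in \<open>simp add: list_face_def\<close>)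
  ultimately have "continuous_map ?D (prod_topology (nsphere i) Y) (\<lambda>t. (?f t, \<tau> (bary (map snd l) t)))"
    by (rule continuous_map_pairedI)
  then show ?thesis
    using l by (simp add: singular_simplex_def sphere_prism_def)
qed

text \<open>Evaluation of a cochain on \<open>s\<^sub>k \<times> z\<close>, where \<open>z\<close> is the sum of the simplices in \<open>S\<close> and \<open>s\<^sub>k\<close>
  is the hemisphere of the boundary of the cross polytope consisting of the simplices
  \<open>(\<plusminus> e\<^sub>0, \<dots>, \<plusminus> e\<^bsub>k - 1\<^esub>, e\<^sub>k)\<close>, the set \<open>N\<close> recording the negative signs.\<close>

definition sphere_cross ::
    "((nat \<Rightarrow> real) \<Rightarrow> 'a) set \<Rightarrow> nat \<Rightarrow> nat \<Rightarrow> ((nat \<Rightarrow> real) \<times> 'a) cochain \<Rightarrow> bit" where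
  "sphere_cross S m k \<phi> =
     (\<Sum>\<tau>\<in>S. \<Sum>N\<in>Pow {..<k}. shuffle_sum [0..<Suc k] [0..<Suc m] (\<lambda>l. \<phi> (sphere_prism N \<tau> l)))"

lemma sphere_cross_add:
  "sphere_cross S m k (\<lambda>\<sigma>. \<phi> \<sigma> + \<psi> \<sigma>) = sphere_cross S m k \<phi> + sphere_cross S m k \<psi>"
  by (simp add: sphere_cross_def shuffle_sum_add sum.distrib del: upt_Suc)

lemma sphere_cross_zero [simp]: "sphere_cross S m k (\<lambda>\<sigma>. 0) = 0"
  by (simp add: sphere_cross_def del: upt_Suc)

lemma sphere_cross_cong_prism:
  assumes "\<And>\<tau> N l. \<lbrakk>\<tau> \<in> S; N \<subseteq> {..<k}; length l = Suc (k + m); set l \<subseteq> {..k} \<times> {..m}\<rbrakk>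
     \<Longrightarrow> \<phi> (sphere_prism N \<tau> l) = \<psi> (sphere_prism N \<tau> l)"
  shows "sphere_cross S m k \<phi> = sphere_cross S m k \<psi>"
  unfolding sphere_cross_def
proof (intro sum.cong refl shuffle_sum_cong)
  fix \<tau> N l
  assume *: "\<tau> \<in> S" "N \<in> Pow {..<k}" "set l \<subseteq> set [0..<Suc k] \<times> set [0..<Suc m]"
    "Suc (length l) = length [0..<Suc k] + length [0..<Suc m]"
  have "set [0..<Suc k] = {..k}" "set [0..<Suc m] = {..m}"
    by auto
  then show "\<phi> (sphere_prism N \<tau> l) = \<psi> (sphere_prism N \<tau> l)"
    using * by (intro assms) (auto simp del: upt_Suc)
qed

lemma sphere_cross_cong:
  assumes "\<And>\<tau>. \<tau> \<in> S \<Longrightarrow> singular_simplex m Y \<tau>" "k \<le> i"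
    and "\<And>\<sigma>. singular_simplex (k + m) (prod_topology (nsphere i) Y) \<sigma> \<Longrightarrow> \<phi> \<sigma> = \<psi> \<sigma>"
  shows "sphere_cross S m k \<phi> = sphere_cross S m k \<psi>"
proof (rule sphere_cross_cong_prism)
  fix \<tau> N l
  assume *: "\<tau> \<in> S" "length l = Suc (k + m)" "set l \<subseteq> {..k} \<times> {..m}"
  then have "set l \<subseteq> {..i} \<times> {..m}"
    using assms(2) by fastforce
  then show "\<phi> (sphere_prism N \<tau> l) = \<psi> (sphere_prism N \<tau> l)"
    using * assms(1) by (intro assms(3) singular_simplex_sphere_prism)
qed

lemma sum_Pow_insert:
  fixes f :: "'b set \<Rightarrow> 'c::comm_monoid_add"
  assumes "finite B" "j \<notin> B"
  shows "(\<Sum>N\<in>Pow (insert j B). f N) = (\<Sum>N\<in>Pow B. f N + f (insert j N))"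
proof -
  have "inj_on (insert j) (Pow B)"
    using assms(2) by (auto simp: inj_on_def)
  moreover have "Pow B \<inter> insert j ` Pow B = {}"
    using assms(2) by auto
  ultimately show ?thesis
    using assms(1) by (simp add: Pow_insert sum.union_disjoint sum.reindex sum.distrib)
qed

text \<open>By \<open>shuffle_sum_boundary\<close>, with the faces in the direction of
  \<open>z\<close> cancelling because \<open>z\<close> is a cycle: the hypothesis says that every
  coboundary is zero on it.\<close>

lemma sphere_cross_cobd:
  assumes "\<And>\<phi>. (\<Sum>\<tau>\<in>S. cobd m \<phi> \<tau>) = 0"
  shows "sphere_cross S m k (cobd (k + m) \<phi>) =
    (\<Sum>\<tau>\<in>S. \<Sum>N\<in>Pow {..<k}.
      list_bd (\<lambda>xs. shuffle_sum xs [0..<Suc m] (\<lambda>l. \<phi> (sphere_prism N \<tau> l))) [0..<Suc k])"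
proof (cases "k + m = 0")
  case True
  then show ?thesis
    by (simp add: sphere_cross_def cobd_def)
next
  case False
  let ?G = "\<lambda>N \<tau> l. \<phi> (sphere_prism N \<tau> l)"
  \<comment> \<open>For fixed \<open>xs\<close> and \<open>N\<close> the shuffle sum is itself a
    cochain of \<open>\<tau>\<close>, so the cycle hypothesis applies to its coboundary.\<close>
  have vert: "(\<Sum>\<tau>\<in>S. list_bd (\<lambda>ys. shuffle_sum xs ys (?G N \<tau>)) [0..<Suc m]) = 0" for N xs
  proof (cases m)
    case 0
    then show ?thesis by simp
  next
    case (Suc m')
    let ?\<psi> = "\<lambda>\<tau>. shuffle_sum xs [0..<m] (?G N \<tau>)"
    have "shuffle_sum xs (map (skip j) [0..<m]) (?G N \<tau>) = ?\<psi> (singular_face m j \<tau>)" for j \<tau>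
    proof (cases "xs = []")
      case False
      have "shuffle_sum xs (map (skip j) [0..<m]) (?G N \<tau>) =
          shuffle_sum xs [0..<m] (\<lambda>l. ?G N \<tau> (map (map_prod id (skip j)) l))"
        using shuffle_sum_map[of id xs "skip j" "[0..<m]"] by simp
      also have "\<dots> = ?\<psi> (singular_face m j \<tau>)"
      proof (rule shuffle_sum_cong)
        fix l
        assume l: "set l \<subseteq> set xs \<times> set [0..<m]" "Suc (length l) = length xs + length [0..<m]"
        show "?G N \<tau> (map (map_prod id (skip j)) l) = ?G N (singular_face m j \<tau>) l"
        proof -
          have "l \<noteq> []"
            using l(2) False Suc by auto
          moreover have "snd ` set l \<subseteq> {..m'}"
            using l(1) Suc by force
          ultimately show ?thesis
            using sphere_prism_singular_face[of l m' N j \<tau>] Suc by simp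
        qed
      qed
      finally show ?thesis .
    qed simp
    then have "list_bd (\<lambda>ys. shuffle_sum xs ys (?G N \<tau>)) [0..<Suc m] = cobd m ?\<psi> \<tau>" for \<tau>
      unfolding list_bd_upt by (simp add: cobd_def Suc del: upt_Suc)
    then show ?thesis
      using assms by simp
  qed
  have "shuffle_sum [0..<Suc k] [0..<Suc m] (\<lambda>l. cobd (k + m) \<phi> (sphere_prism N \<tau> l)) =
      list_bd (\<lambda>xs. shuffle_sum xs [0..<Suc m] (?G N \<tau>)) [0..<Suc k] +
      list_bd (\<lambda>ys. shuffle_sum [0..<Suc k] ys (?G N \<tau>)) [0..<Suc m]" for N \<tau>
  proof -
    have "shuffle_sum [0..<Suc k] [0..<Suc m] (\<lambda>l. cobd (k + m) \<phi> (sphere_prism N \<tau> l)) =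
        shuffle_sum [0..<Suc k] [0..<Suc m] (list_bd (?G N \<tau>))"
    proof (rule shuffle_sum_cong)
      fix l :: "(nat \<times> nat) list"
      assume "Suc (length l) = length [0..<Suc k] + length [0..<Suc m]"
      then have "length l = Suc (k + m)"
        by simp
      then show "cobd (k + m) \<phi> (sphere_prism N \<tau> l) = list_bd (?G N \<tau>) l"
        unfolding list_bd_eq_sum cobd_def using False
        by (auto simp: lessThan_Suc_atMost singular_face_sphere_prism intro!: sum.cong)
    qed
    also have "\<dots> = list_bd (\<lambda>xs. shuffle_sum xs [0..<Suc m] (?G N \<tau>)) [0..<Suc k] +
      list_bd (\<lambda>ys. shuffle_sum [0..<Suc k] ys (?G N \<tau>)) [0..<Suc m]"
      unfolding shuffle_sum_boundary using False by auto
    finally show ?thesis .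
  qed
  then have "sphere_cross S m k (cobd (k + m) \<phi>) =
     (\<Sum>\<tau>\<in>S. \<Sum>N\<in>Pow {..<k}. list_bd (\<lambda>xs. shuffle_sum xs [0..<Suc m] (?G N \<tau>)) [0..<Suc k]) +
     (\<Sum>N\<in>Pow {..<k}. \<Sum>\<tau>\<in>S. list_bd (\<lambda>ys. shuffle_sum [0..<Suc k] ys (?G N \<tau>)) [0..<Suc m])"
    unfolding sphere_cross_def sum.swap[of _ S "Pow {..<k}"] by (simp add: sum.distrib del: upt_Suc)
  then show ?thesis
    unfolding vert by simp
qed

lemma sphere_cross_cobd_0:
  assumes "\<And>\<phi>. (\<Sum>\<tau>\<in>S. cobd m \<phi> \<tau>) = 0"
  shows "sphere_cross S m 0 (cobd m \<phi>) = 0"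
  using sphere_cross_cobd[OF assms, of 0] by simp

text \<open>The dual of the boundary formula for hemispheres. A face that omits a vertex
  \<open>j \<le> k\<close> occurs once for each sign at \<open>j\<close>, and the two cancel. The
  faces that omit the last vertex form a whole sphere, which the sign at \<open>k\<close> divides
  into \<open>s\<^sub>k\<close> and its antipode.\<close>

lemma sphere_cross_cobd_Suc:
  assumes "\<And>\<phi>. (\<Sum>\<tau>\<in>S. cobd m \<phi> \<tau>) = 0"
  shows "sphere_cross S m (Suc k) (cobd (Suc k + m) \<phi>) =
    sphere_cross S m k \<phi> + sphere_cross S m k (\<lambda>\<sigma>. \<phi> (simplex_map (k + m) (map_prod antipode id) \<sigma>))"
proof -
  let ?ys = "[0..<Suc m]"
  let ?H = "\<lambda>xs \<tau> N. shuffle_sum xs ?ys (\<lambda>l. \<phi> (sphere_prism N \<tau> l))"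
  have pairs: "(\<Sum>N\<in>Pow {..<Suc k}. ?H (map (skip j) [0..<Suc k]) \<tau> N) = 0" if "j \<le> k" for j \<tau>
  proof -
    let ?B = "{..<Suc k} - {j}"
    have B: "{..<Suc k} = insert j ?B"
      using that by auto
    have "?H (map (skip j) [0..<Suc k]) \<tau> (insert j N) = ?H (map (skip j) [0..<Suc k]) \<tau> N" for N
    proof (rule shuffle_sum_cong)
      fix l
      assume "set l \<subseteq> set (map (skip j) [0..<Suc k]) \<times> set ?ys"
      then have "j \<notin> fst ` set l"
        by (auto simp: skip_def split: if_splits)
      then have "sphere_prism (insert j N) \<tau> l = sphere_prism N \<tau> l"
        by (intro sphere_prism_cong) auto
      then show "\<phi> (sphere_prism (insert j N) \<tau> l) = \<phi> (sphere_prism N \<tau> l)"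
        by simp
    qed
    then show ?thesis
      by (subst B, subst sum_Pow_insert) (auto simp del: upt_Suc)
  qed
  have top: "(\<Sum>N\<in>Pow {..<Suc k}. ?H [0..<Suc k] \<tau> N) = (\<Sum>N\<in>Pow {..<k}. ?H [0..<Suc k] \<tau> N) +
     (\<Sum>N\<in>Pow {..<k}. shuffle_sum [0..<Suc k] ?ys
        (\<lambda>l. \<phi> (simplex_map (k + m) (map_prod antipode id) (sphere_prism N \<tau> l))))" for \<tau>
  proof -
    have "(\<Sum>N\<in>Pow {..<Suc k}. ?H [0..<Suc k] \<tau> N) =
        (\<Sum>N\<in>Pow {..<k}. ?H [0..<Suc k] \<tau> N) + (\<Sum>N\<in>Pow {..<k}. ?H [0..<Suc k] \<tau> (insert k N))"
      unfolding lessThan_Suc by (subst sum_Pow_insert) (auto simp: sum.distrib simp del: upt_Suc)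
    \<comment> \<open>The antipode reverses every sign, so it carries the simplex of
      \<open>N\<close> to the one of \<open>insert k ({..<k} - N)\<close>; hence the reindexing by
      complements.\<close>
    also have "(\<Sum>N\<in>Pow {..<k}. ?H [0..<Suc k] \<tau> (insert k N)) =
        (\<Sum>N\<in>Pow {..<k}. ?H [0..<Suc k] \<tau> (insert k ({..<k} - N)))"
      by (rule sum.reindex_bij_witness[where i = "\<lambda>N. {..<k} - N" and j = "\<lambda>N. {..<k} - N"])
         (auto simp: double_diff simp del: upt_Suc)
    also have "\<dots> = (\<Sum>N\<in>Pow {..<k}. shuffle_sum [0..<Suc k] ?ys
        (\<lambda>l. \<phi> (simplex_map (k + m) (map_prod antipode id) (sphere_prism N \<tau> l))))"
    proof (intro sum.cong refl shuffle_sum_cong)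
      fix N l
      assume l: "set l \<subseteq> set [0..<Suc k] \<times> set ?ys" "Suc (length l) = length [0..<Suc k] + length ?ys"
        and N: "N \<in> Pow {..<k}"
      then have "fst ` set l \<subseteq> {..k}"
        by force
      then have "sphere_prism (insert k ({..<k} - N)) \<tau> l = sphere_prism (- N) \<tau> l"
        using N by (intro sphere_prism_cong) (fastforce simp: subset_iff)
      then show "\<phi> (sphere_prism (insert k ({..<k} - N)) \<tau> l) =
          \<phi> (simplex_map (k + m) (map_prod antipode id) (sphere_prism N \<tau> l))"
        using l(2) by (subst simplex_map_antipode_sphere_prism) auto
    qed
    finally show ?thesis .
  qed
  have "(\<Sum>N\<in>Pow {..<Suc k}. list_bd (\<lambda>xs. ?H xs \<tau> N) [0..<Suc (Suc k)]) =
      (\<Sum>N\<in>Pow {..<Suc k}. ?H [0..<Suc k] \<tau> N)" for \<tau>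
  proof -
    have "map (skip (Suc k)) [0..<Suc k] = [0..<Suc k]"
      by (rule map_idI) (auto simp: skip_def)
    then show ?thesis
      unfolding list_bd_upt sum.swap[of _ "{..Suc k}" "Pow {..<Suc k}"]
      by (simp add: pairs del: upt_Suc)
  qed
  then show ?thesis
    unfolding sphere_cross_cobd[OF assms] by (simp add: top sphere_cross_def sum.distrib del: upt_Suc)
qed

text \<open>The projection forgets the signs, so for \<open>k > 0\<close> the \<open>2 ^ k\<close>
  equal contributions cancel. For \<open>k = 0\<close> there is one point of the sphere and one
  path.\<close>

lemma sphere_cross_snd:
  assumes "\<And>\<tau>. \<tau> \<in> S \<Longrightarrow> singular_simplex m Y \<tau>"
  shows "sphere_cross S m k (\<lambda>\<sigma>. \<phi> (simplex_map (k + m) snd \<sigma>)) = (if k = 0 then \<Sum>\<tau>\<in>S. \<phi> \<tau> else 0)"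
proof -
  have "shuffle_sum [0..<Suc k] [0..<Suc m] (\<lambda>l. \<phi> (simplex_map (k + m) snd (sphere_prism N \<tau> l))) =
      shuffle_sum [0..<Suc k] [0..<Suc m] (\<lambda>l. \<phi> (list_face (map snd l) \<tau>))" for N \<tau>
    by (rule shuffle_sum_cong) (simp add: simplex_map_snd_sphere_prism)
  then have *: "sphere_cross S m k (\<lambda>\<sigma>. \<phi> (simplex_map (k + m) snd \<sigma>)) =
      (\<Sum>\<tau>\<in>S. \<Sum>N\<in>Pow {..<k}. shuffle_sum [0..<Suc k] [0..<Suc m] (\<lambda>l. \<phi> (list_face (map snd l) \<tau>)))"
    by (simp add: sphere_cross_def del: upt_Suc)
  show ?thesis
  proof (cases k)
    case 0
    have "shuffle_sum [0..<Suc 0] [0..<Suc m] (\<lambda>l. \<phi> (list_face (map snd l) \<tau>)) = \<phi> \<tau>" if "\<tau> \<in> S" for \<tau>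
    proof -
      have "[0..<Suc 0] = [0]"
        by simp
      then have "shuffle_sum [0..<Suc 0] [0..<Suc m] (\<lambda>l. \<phi> (list_face (map snd l) \<tau>)) =
          \<phi> (list_face (map snd (map (Pair (0::nat)) [0..<Suc m])) \<tau>)"
        by (simp only:) (rule shuffle_sum_singleton, simp)
      also have "map snd (map (Pair (0::nat)) [0..<Suc m]) = [0..<Suc m]"
        by (rule map_idI[of _ "snd \<circ> Pair 0", simplified map_map[symmetric]]) simp
      finally show ?thesis
        using list_face_upt[OF assms[OF that]] by simp
    qed
    then show ?thesis
      using * 0 by (simp del: upt_Suc)
  next
    case (Suc k')
    have "(\<Sum>N\<in>Pow {..<k}. c) = 0" for c :: bit
      by (simp add: card_Pow Suc)
    then show ?thesis
      unfolding * using Suc by (simp only: sum.neutral_const) simp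
  qed
qed

subsection \<open>Equivariant cochains\<close>

abbreviation (input) sphere_times :: "nat \<Rightarrow> 'a topology \<Rightarrow> ((nat \<Rightarrow> real) \<times> 'a) topology" where
  "sphere_times i Y \<equiv> prod_topology (nsphere i) Y"

abbreviation flip :: "(nat \<Rightarrow> real) \<times> 'a \<Rightarrow> (nat \<Rightarrow> real) \<times> 'a" where
  "flip \<equiv> map_prod antipode id"

lemma continuous_map_flip: "continuous_map (sphere_times i Y) (sphere_times i Y) flip"
proof -
  have "continuous_map (nsphere i) (nsphere i) antipode"
    unfolding nsphere antipode_def continuous_map_in_subtopology continuous_map_componentwise_UNIV
    by (auto intro!: continuous_map_minus continuous_map_from_subtopology continuous_map_product_projection)
  then show ?thesis
    by (simp add: map_prod_def continuous_map_prod_top)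
qed

lemma flip_flip [simp]: "flip (flip x) = x"
  by (cases x) (simp add: antipode_def)

lemma singular_simplex_flip:
  "singular_simplex n (sphere_times i Y) \<sigma> \<Longrightarrow> singular_simplex n (sphere_times i Y) (simplex_map n flip \<sigma>)"
  by (rule singular_simplex_simplex_map[OF _ continuous_map_flip])

lemma simplex_map_flip_flip:
  assumes "singular_simplex n X \<sigma>"
  shows "simplex_map n flip (simplex_map n flip \<sigma>) = \<sigma>"
proof -
  have "simplex_map n (flip \<circ> flip) \<sigma> = \<sigma>"
    by (rule simplex_map_id_gen[OF assms]) simp
  then show ?thesis
    by (simp add: simplex_map_compose)
qed

lemma simplex_map_snd_flip: "simplex_map n snd (simplex_map n flip \<sigma>) = simplex_map n snd \<sigma>"
  by (auto simp: simplex_map_def fun_eq_iff)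

text \<open>Equivariant cochains of total degree \<open>i + m\<close> are families \<open>c\<close> with \<open>c k\<close> of degree \<open>k + m\<close>
  and differential \<open>(D c) k = \<delta> (c k) + (1 + flip\<^sup>*) (c (k + 1))\<close>. Their evaluation on
  \<open>s\<^sub>0 \<times> z, \<dots>, s\<^sub>i \<times> z\<close> kills \<open>D e\<close>.\<close>

lemma sum_sphere_cross_eq:
  assumes cyc: "\<And>\<phi>. (\<Sum>\<tau>\<in>S. cobd m \<phi> \<tau>) = 0"
    and S: "\<And>\<tau>. \<tau> \<in> S \<Longrightarrow> singular_simplex m Y \<tau>"
    and rel: "\<And>k \<sigma>. \<lbrakk>k \<le> i; singular_simplex (k + m) (sphere_times i Y) \<sigma>\<rbrakk> \<Longrightarrow>
      c k \<sigma> = c' k \<sigma> + (cobd (k + m) (e k) \<sigma> + (e (Suc k) \<sigma> + e (Suc k) (simplex_map (k + m) flip \<sigma>)))"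
    and top: "\<And>\<sigma>. singular_simplex (i + m) (sphere_times i Y) \<sigma> \<Longrightarrow> e (Suc i) \<sigma> = 0"
  shows "(\<Sum>k\<le>i. sphere_cross S m k (c k)) = (\<Sum>k\<le>i. sphere_cross S m k (c' k))"
proof -
  let ?X = "sphere_cross S m"
  \<comment> \<open>\<open>B k\<close> arises from the coboundary at level \<open>k + 1\<close> and
    again from the equivariant term at level \<open>k\<close>. The two copies cancel, and the
    unpaired \<open>B i\<close> is zero by \<open>top\<close>.\<close>
  define B where "B k = ?X k (e (Suc k)) + ?X k (\<lambda>\<sigma>. e (Suc k) (simplex_map (k + m) flip \<sigma>))" for k
  have "?X k (c k) = ?X k (c' k) + (?X k (cobd (k + m) (e k)) + B k)" if "k \<le> i" for k
    unfolding B_def sphere_cross_add[symmetric]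
    by (rule sphere_cross_cong[OF S that]) (use rel that in auto)
  then have "(\<Sum>k\<le>i. ?X k (c k)) =
      (\<Sum>k\<le>i. ?X k (c' k)) + ((\<Sum>k\<le>i. ?X k (cobd (k + m) (e k))) + (\<Sum>k\<le>i. B k))"
    by (simp add: sum.distrib)
  also have "(\<Sum>k\<le>i. ?X k (cobd (k + m) (e k))) = (\<Sum>k<i. B k)"
  proof -
    have "(\<Sum>k\<le>i. ?X k (cobd (k + m) (e k))) =
        ?X 0 (cobd (0 + m) (e 0)) + (\<Sum>k<i. ?X (Suc k) (cobd (Suc k + m) (e (Suc k))))"
      unfolding lessThan_Suc_atMost[symmetric] by (rule sum.lessThan_Suc_shift)
    then show ?thesis
      using sphere_cross_cobd_0[OF cyc] sphere_cross_cobd_Suc[OF cyc] by (simp add: B_def)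
  qed
  also have "(\<Sum>k\<le>i. B k) = (\<Sum>k<i. B k)"
  proof -
    have "B i = 0"
      unfolding B_def sphere_cross_add[symmetric]
      using sphere_cross_cong[OF S order_refl, where \<psi> = "\<lambda>_. 0"]
      by (metis (no_types, lifting) add.right_neutral singular_simplex_flip sphere_cross_zero top)
    then show ?thesis
      by (simp flip: lessThan_Suc_atMost)
  qed
  finally show ?thesis
    by simp
qed

section \<open>Invariance of the evaluation under barycentric subdivision\<close>

lemma eval_chain_singular_subdivision:
  "eval_chain (\<lambda>\<sigma>. eval_chain \<phi> (singular_subdivision n (frag_of \<sigma>))) c = eval_chain \<phi> (singular_subdivision n c)"
  by (simp add: singular_subdivision_def eval_chain_extend)

lemma eval_chain_sd_homotopy:
  "eval_chain (\<lambda>\<sigma>. eval_chain \<phi> (sd_homotopy n (frag_of \<sigma>))) c = eval_chain \<phi> (sd_homotopy n c)"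
  by (simp add: sd_homotopy_def eval_chain_extend)

text \<open>Composition with \<open>sd_homotopy\<close> shows that one subdivision changes an
  equivariant cocycle by some \<open>D e\<close>. The subdivided family is again an equivariant
  cocycle, so the induction on \<open>r\<close> is over arbitrary \<open>c\<close>.\<close>

lemma sum_sphere_cross_subdivision:
  assumes cyc: "\<And>\<phi>. (\<Sum>\<tau>\<in>S. cobd m \<phi> \<tau>) = 0"
    and S: "\<And>\<tau>. \<tau> \<in> S \<Longrightarrow> singular_simplex m Y \<tau>"
    and cocycle: "\<And>k \<sigma>. \<lbrakk>k \<le> i; singular_simplex (Suc (k + m)) (sphere_times i Y) \<sigma>\<rbrakk> \<Longrightarrow>
      cobd (Suc (k + m)) (c k) \<sigma> = c (Suc k) \<sigma> + c (Suc k) (simplex_map (Suc (k + m)) flip \<sigma>)"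
    and top: "\<And>\<sigma>. singular_simplex (Suc (i + m)) (sphere_times i Y) \<sigma> \<Longrightarrow> c (Suc i) \<sigma> = 0"
  shows "(\<Sum>k\<le>i. sphere_cross S m k (c k)) =
    (\<Sum>k\<le>i. sphere_cross S m k (\<lambda>\<sigma>. eval_chain (c k) ((singular_subdivision (k + m) ^^ r) (frag_of \<sigma>))))"
  using cocycle top
proof (induction r arbitrary: c)
  case 0
  then show ?case by simp
next
  case (Suc r c)
  note cocycle = Suc.prems(1) and top = Suc.prems(2)
  let ?N = "sphere_times i Y"
  define d where "d k \<sigma> = eval_chain (c k) (singular_subdivision (k + m) (frag_of \<sigma>))" for k \<sigma>
  \<comment> \<open>The subtraction truncates only for \<open>k = m = 0\<close>; there
    \<open>e 0\<close> enters only through \<open>cobd 0\<close>, which is zero.\<close>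
  define e where "e k \<sigma> = eval_chain (c k) (sd_homotopy (k + m - 1) (frag_of \<sigma>))" for k \<sigma>
  have cocycle': "eval_chain (cobd (Suc (k + m)) (c k)) x =
      eval_chain (c (Suc k)) x + eval_chain (c (Suc k)) (chain_map (Suc (k + m)) flip x)"
    if "k \<le> i" "singular_chain (Suc (k + m)) ?N x" for k x
    unfolding eval_chain_chain_map eval_chain_add_left[symmetric]
    by (rule eval_chain_cong[OF that(2)]) (rule cocycle[OF that(1)])
  have "(\<Sum>k\<le>i. sphere_cross S m k (c k)) = (\<Sum>k\<le>i. sphere_cross S m k (d k))"
  proof (rule sum_sphere_cross_eq[OF cyc S, where e = e])
    fix k \<sigma>
    assume k: "k \<le> i" and \<sigma>: "singular_simplex (k + m) ?N \<sigma>"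
    let ?x = "frag_of \<sigma>"
    have x: "singular_chain (k + m) ?N ?x"
      using \<sigma> by (simp add: singular_chain_of)
    have "d k \<sigma> + c k \<sigma> = eval_chain (c k) (chain_boundary (Suc (k + m)) (sd_homotopy (k + m) ?x) +
        sd_homotopy (k + m - 1) (chain_boundary (k + m) ?x))"
      unfolding chain_boundary_sd_homotopy[OF x] by (simp add: d_def eval_chain_diff)
    also have "\<dots> = eval_chain (cobd (Suc (k + m)) (c k)) (sd_homotopy (k + m) ?x) + cobd (k + m) (e k) \<sigma>"
      unfolding eval_chain_add eval_chain_boundary e_def[abs_def] cobd_eq_eval_chain[of "k + m"]
        eval_chain_sd_homotopy ..
    also have "eval_chain (cobd (Suc (k + m)) (c k)) (sd_homotopy (k + m) ?x) =
        e (Suc k) \<sigma> + e (Suc k) (simplex_map (k + m) flip \<sigma>)"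
      unfolding cocycle'[OF k singular_chain_sd_homotopy[OF x]] e_def sd_homotopy_chain_map[symmetric]
      by simp
    finally show "c k \<sigma> = d k \<sigma> + (cobd (k + m) (e k) \<sigma> + (e (Suc k) \<sigma> + e (Suc k) (simplex_map (k + m) flip \<sigma>)))"
      by (metis add.commute bit_add_cancel)
  next
    fix \<sigma>
    assume "singular_simplex (i + m) ?N \<sigma>"
    then have "singular_chain (Suc (i + m)) ?N (sd_homotopy (i + m) (frag_of \<sigma>))"
      by (intro singular_chain_sd_homotopy) (simp add: singular_chain_of)
    then have "eval_chain (c (Suc i)) (sd_homotopy (i + m) (frag_of \<sigma>)) = eval_chain (\<lambda>_. 0) (sd_homotopy (i + m) (frag_of \<sigma>))"
      by (rule eval_chain_cong) (rule top)
    then show "e (Suc i) \<sigma> = 0"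
      by (simp add: e_def eval_chain_def)
  qed
  also have "\<dots> = (\<Sum>k\<le>i. sphere_cross S m k (\<lambda>\<sigma>. eval_chain (d k) ((singular_subdivision (k + m) ^^ r) (frag_of \<sigma>))))"
  proof (rule Suc.IH)
    fix k \<sigma>
    assume k: "k \<le> i" and \<sigma>: "singular_simplex (Suc (k + m)) ?N \<sigma>"
    let ?x = "frag_of \<sigma>"
    have x: "singular_chain (Suc (k + m)) ?N ?x"
      using \<sigma> by (simp add: singular_chain_of)
    have "cobd (Suc (k + m)) (d k) \<sigma> = eval_chain (c k) (singular_subdivision (k + m) (chain_boundary (Suc (k + m)) ?x))"
      unfolding cobd_eq_eval_chain d_def[abs_def] eval_chain_singular_subdivision ..
    also have "\<dots> = eval_chain (cobd (Suc (k + m)) (c k)) (singular_subdivision (Suc (k + m)) ?x)"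
      using chain_boundary_singular_subdivision[OF x] by (simp flip: eval_chain_boundary)
    also have "\<dots> = d (Suc k) \<sigma> + d (Suc k) (simplex_map (Suc (k + m)) flip \<sigma>)"
      unfolding cocycle'[OF k singular_chain_singular_subdivision[OF x]] d_def
        naturality_singular_subdivision[OF x, symmetric] by simp
    finally show "cobd (Suc (k + m)) (d k) \<sigma> = d (Suc k) \<sigma> + d (Suc k) (simplex_map (Suc (k + m)) flip \<sigma>)" .
  next
    fix \<sigma>
    assume "singular_simplex (Suc (i + m)) ?N \<sigma>"
    then have "singular_chain (Suc (i + m)) ?N (singular_subdivision (Suc (i + m)) (frag_of \<sigma>))"
      by (intro singular_chain_singular_subdivision) (simp add: singular_chain_of)
    then have "eval_chain (c (Suc i)) (singular_subdivision (Suc (i + m)) (frag_of \<sigma>)) =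
        eval_chain (\<lambda>_. 0) (singular_subdivision (Suc (i + m)) (frag_of \<sigma>))"
      by (rule eval_chain_cong) (rule top)
    then show "d (Suc i) \<sigma> = 0"
      by (simp add: d_def eval_chain_def)
  qed
  also have "\<dots> = (\<Sum>k\<le>i. sphere_cross S m k (\<lambda>\<sigma>. eval_chain (c k) ((singular_subdivision (k + m) ^^ Suc r) (frag_of \<sigma>))))"
    unfolding d_def[abs_def] eval_chain_singular_subdivision by simp
  finally show ?case .
qed

text \<open>In the coboundary formula the terms with \<open>\<delta> u\<close> vanish. As
  \<open>flip\<close> is an involution, pulling back along it exchanges \<open>u\<close> and
  \<open>u'\<close>, which turns the interchanged product into the flipped one.\<close>

lemma cobd_cup_flip:
  assumes u: "\<And>\<sigma>. singular_simplex (Suc p) (sphere_times i Y) \<sigma> \<Longrightarrow> cobd (Suc p) u \<sigma> = 0"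
    and \<sigma>: "singular_simplex (Suc n) (sphere_times i Y) \<sigma>"
  defines "u' \<equiv> \<lambda>\<sigma>. u (simplex_map p flip \<sigma>)"
  shows "cobd (Suc n) (cup J (Suc p) (Suc p) n u u') \<sigma> =
    cup (J - 1) (Suc p) (Suc p) (Suc n) u u' \<sigma> + cup (J - 1) (Suc p) (Suc p) (Suc n) u u' (simplex_map (Suc n) flip \<sigma>)"
proof -
  let ?N = "sphere_times i Y"
  have u': "cobd (Suc p) u' \<sigma> = 0" if "singular_simplex (Suc p) ?N \<sigma>" for \<sigma>
    using cobd_simplex_map[of "Suc p" u flip \<sigma>] u[OF singular_simplex_flip[OF that]] by (simp add: u'_def)
  have 1: "cup J (Suc (Suc p)) (Suc p) (Suc n) (cobd (Suc p) u) u' \<sigma> = 0"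
    using cup_cong[OF \<sigma>, of "Suc (Suc p)" "Suc p" "cobd (Suc p) u" "\<lambda>_. 0" u' u'] u by simp
  have 2: "cup J (Suc p) (Suc (Suc p)) (Suc n) u (cobd (Suc p) u') \<sigma> = 0"
    using cup_cong[OF \<sigma>, of "Suc p" "Suc (Suc p)" u u "cobd (Suc p) u'" "\<lambda>_. 0"] u' by simp
  have 3: "cup (J - 1) (Suc p) (Suc p) (Suc n) u u' (simplex_map (Suc n) flip \<sigma>) =
      cup (J - 1) (Suc p) (Suc p) (Suc n) u' u \<sigma>"
    by (subst cup_simplex_map) (auto simp: u'_def simplex_map_flip_flip intro!: cup_cong[OF \<sigma>])
  show ?thesis
    using cobd_cup[of "Suc p" "Suc p" "Suc n" J u u' \<sigma>] unfolding 3 by (simp add: 1 2)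
qed

text \<open>In the notation above, the second summand on the right is a component of \<open>D F\<close>: the products
  \<open>u \<union>\<^sub>j flip\<^sup>* u\<close> and \<open>w \<union>\<^sub>j w\<close> are equivariantly cohomologous.\<close>

lemma cup_flip_add_coboundary:
  fixes w b :: "((nat \<Rightarrow> real) \<times> 'a) cochain"
  assumes w: "\<And>\<sigma>. singular_simplex (Suc p) (sphere_times i Y) \<sigma> \<Longrightarrow> cobd (Suc p) w \<sigma> = 0"
    and w_flip: "\<And>\<sigma>. w (simplex_map p flip \<sigma>) = w \<sigma>"
    and \<sigma>: "singular_simplex n (sphere_times i Y) \<sigma>" and p: "p = Suc q"
  defines "u \<equiv> \<lambda>\<sigma>. w \<sigma> + cobd p b \<sigma>"
  defines "u' \<equiv> \<lambda>\<sigma>. u (simplex_map p flip \<sigma>)" and "b' \<equiv> \<lambda>\<sigma>. b (simplex_map q flip \<sigma>)"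
  defines "F \<equiv> \<lambda>J n \<sigma>. cup J p (Suc p) n b u' \<sigma> + cup J (Suc p) p n w b' \<sigma> + cup (J - 1) p p n b' b \<sigma>"
  shows "cup J (Suc p) (Suc p) n u u' \<sigma> = cup J (Suc p) (Suc p) n w w \<sigma> +
    (cobd n (F J (n - 1)) \<sigma> + (F (J - 1) n \<sigma> + F (J - 1) n (simplex_map n flip \<sigma>)))"
proof -
  let ?N = "sphere_times i Y"
  let ?P = "Suc p"
  have p1: "p \<ge> 1" "?P \<ge> 1" "p - 1 = q"
    using p by auto
  have bb: "cobd ?P (cobd p b) \<tau> = 0" if "singular_simplex ?P ?N \<tau>" for \<tau>
    using cobd_cobd[OF that] by simp
  have u_co: "cobd ?P u \<tau> = 0" if "singular_simplex ?P ?N \<tau>" for \<tau>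
    using w[OF that] bb[OF that] by (simp add: u_def cobd_add)
  have u'_co: "cobd ?P u' \<tau> = 0" if "singular_simplex ?P ?N \<tau>" for \<tau>
    using cobd_simplex_map[of ?P u flip \<tau>] u_co[OF singular_simplex_flip[OF that]] by (simp add: u'_def)
  have u'_eq: "u' \<tau> = w \<tau> + cobd p b' \<tau>" for \<tau>
    using cobd_simplex_map[of p b flip \<tau>] unfolding p1(3) by (simp add: u'_def u_def b'_def w_flip)
  have u'_fun: "u' = (\<lambda>\<tau>. w \<tau> + cobd p b' \<tau>)"
    by (simp add: fun_eq_iff u'_eq)
  note cong = cup_cong[OF \<sigma>]
  have z1: "cup J p (Suc ?P) n b (cobd ?P u') \<sigma> = 0"
    using cong[of p "Suc ?P" b b "cobd ?P u'" "\<lambda>_. 0" J] u'_co p1 by simp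
  have z2: "cup J (Suc ?P) p n (cobd ?P w) b' \<sigma> = 0"
    using cong[of "Suc ?P" p "cobd ?P w" "\<lambda>_. 0" b' b' J] w p1 by simp
  have f1: "cup (J - 1) p ?P n b u' (simplex_map n flip \<sigma>) = cup (J - 1) p ?P n b' u \<sigma>"
    by (subst cup_simplex_map)
       (use p1 in \<open>auto simp: b'_def u'_def simplex_map_flip_flip intro!: cong\<close>)
  have f2: "cup (J - 1) ?P p n w b' (simplex_map n flip \<sigma>) = cup (J - 1) ?P p n w b \<sigma>"
    by (subst cup_simplex_map)
       (use p1 in \<open>auto simp: b'_def w_flip simplex_map_flip_flip intro!: cong\<close>)
  have f3: "cup (J - 1 - 1) p p n b' b (simplex_map n flip \<sigma>) = cup (J - 1 - 1) p p n b b' \<sigma>"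
    by (subst cup_simplex_map)
       (use p1 in \<open>auto simp: b'_def simplex_map_flip_flip intro!: cong\<close>)
  have d: "cobd n (F J (n - 1)) \<sigma> = cobd n (cup J p ?P (n - 1) b u') \<sigma> + cobd n (cup J ?P p (n - 1) w b') \<sigma> +
      cobd n (cup (J - 1) p p (n - 1) b' b) \<sigma>"
    by (simp add: F_def cobd_add)
  \<comment> \<open>The first two summands of \<open>F\<close> supply the products that contain
    \<open>cobd p b\<close> with \<open>u'\<close> and \<open>w\<close> with
    \<open>cobd p b'\<close>. The lower products they produce, combined with the first two summands
    of \<open>F (J - 1)\<close> and their flips, reduce to \<open>cobd p b'\<close> with
    \<open>b\<close> and \<open>b'\<close> with \<open>cobd p b\<close>; the third summand supplies
    these.\<close>
  show ?thesis
    unfolding d cobd_cup[OF p1(1) p1(2)] cobd_cup[OF p1(2) p1(1)] cobd_cup[OF p1(1) p1(1)]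
    unfolding F_def f1 f2 f3 z1 z2
    unfolding u'_fun u_def cup_add_left cup_add_right
    by (simp add: add_ac)
qed

section \<open>The cup-i square is a coboundary when \<open>V\<close> and its flip cover\<close>

lemma singular_chain_iterated_subdivision:
  "singular_chain n X c \<Longrightarrow> singular_chain n X ((singular_subdivision n ^^ r) c)"
  by (induction r) (auto simp: singular_chain_singular_subdivision)

lemma cup_square_eq_cobd:
  assumes a: "\<And>\<sigma>. singular_simplex (Suc p) Y \<sigma> \<Longrightarrow> cobd (Suc p) a \<sigma> = 0"
    and V: "openin (sphere_times i Y) V"
    and cover: "topspace (sphere_times i Y) \<subseteq> V \<union> flip -` V"
    and b: "\<And>\<sigma>. singular_simplex p (subtopology (sphere_times i Y) V) \<sigma> \<Longrightarrow> a (simplex_map p snd \<sigma>) = cobd p b \<sigma>"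
  shows "\<exists>g. \<forall>\<sigma>. singular_simplex m Y \<sigma> \<longrightarrow> cup (Suc i) (Suc p) (Suc p) m a a \<sigma> = cobd m g \<sigma>"
proof (rule cochain_eq_cobd_if_vanishes_on_cycles)
  fix S
  assume "finite S" and S: "\<And>\<tau>. \<tau> \<in> S \<Longrightarrow> singular_simplex m Y \<tau>"
    and cyc: "\<And>\<phi>. (\<Sum>\<tau>\<in>S. cobd m \<phi> \<tau>) = 0"
  let ?N = "sphere_times i Y" and ?P = "Suc p"
  define w where "w = (\<lambda>\<sigma> :: (nat \<Rightarrow> real) \<Rightarrow> (nat \<Rightarrow> real) \<times> 'a. a (simplex_map p snd \<sigma>))"
  \<comment> \<open>\<open>b\<close> is a function on all maps, so \<open>cobd p b\<close> makes
    sense beyond \<open>V\<close>. Thus \<open>u\<close> is cohomologous to \<open>w\<close> on the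
    whole product and zero on the simplices in \<open>V\<close>.\<close>
  define u where "u = (\<lambda>\<sigma>. w \<sigma> + cobd p b \<sigma>)"
  define u' where "u' = (\<lambda>\<sigma>. u (simplex_map p flip \<sigma>))"
  \<comment> \<open>\<open>c k\<close> is the cup-\<open>(i - k)\<close> product. At
    \<open>k = Suc i\<close> the index is 0, which stands for the product with number -1; this gives
    the condition \<open>top\<close>.\<close>
  define c where "c k = cup (Suc i - k) ?P ?P (k + m) u u'" for k
  define c0 where "c0 k = cup (Suc i - k) ?P ?P (k + m) w w" for k
  have w_flip: "w (simplex_map p flip \<sigma>) = w \<sigma>" for \<sigma>
    by (simp add: w_def simplex_map_snd_flip)
  have w_co: "cobd ?P w \<sigma> = 0" if "singular_simplex ?P ?N \<sigma>" for \<sigma>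
  proof -
    have "singular_simplex ?P Y (simplex_map ?P snd \<sigma>)"
      using that continuous_map_snd by (rule singular_simplex_simplex_map)
    then show ?thesis
      using cobd_simplex_map[of ?P a snd \<sigma>] a by (simp add: w_def)
  qed
  have u_co: "cobd ?P u \<sigma> = 0" if "singular_simplex ?P ?N \<sigma>" for \<sigma>
    using w_co[OF that] cobd_cobd[OF that] by (simp add: u_def cobd_add)
  have "(\<Sum>\<tau>\<in>S. cup (Suc i) ?P ?P m a a \<tau>) = (\<Sum>k\<le>i. sphere_cross S m k (c0 k))"
  proof -
    have "sphere_cross S m k (c0 k) = (if k = 0 then \<Sum>\<tau>\<in>S. cup (Suc i) ?P ?P m a a \<tau> else 0)" for k
    proof -
      have c0: "c0 k = (\<lambda>\<sigma>. cup (Suc i - k) ?P ?P (k + m) a a (simplex_map (k + m) snd \<sigma>))"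
        by (simp add: fun_eq_iff c0_def cup_simplex_map w_def)
      show ?thesis
        unfolding c0 by (subst sphere_cross_snd[where S = S, OF S]) (cases "k = 0", simp_all)
    qed
    then show ?thesis
      by simp
  qed
  also have "\<dots> = (\<Sum>k\<le>i. sphere_cross S m k (c k))"
  proof (cases p)
    case 0
    have "u = w"
      by (simp add: fun_eq_iff u_def 0 cobd_def)
    moreover have "u' = w"
      by (simp add: fun_eq_iff u'_def \<open>u = w\<close> w_flip)
    ultimately show ?thesis
      by (simp add: c_def c0_def)
  next
    case (Suc q)
    define b' where "b' = (\<lambda>\<sigma>. b (simplex_map q flip \<sigma>))"
    define F where "F J n \<sigma> = cup J p ?P n b u' \<sigma> + cup J ?P p n w b' \<sigma> + cup (J - 1) p p n b' b \<sigma>" for J n \<sigma>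
    show ?thesis
    proof (rule sum_sphere_cross_eq[OF cyc S, where e = "\<lambda>k. F (Suc i - k) (k + m - 1)", symmetric])
      fix k \<sigma>
      assume "k \<le> i" and \<sigma>: "singular_simplex (k + m) ?N \<sigma>"
      have "Suc i - Suc k = Suc i - k - 1" "Suc k + m - 1 = k + m"
        by auto
      then show "c k \<sigma> = c0 k \<sigma> + (cobd (k + m) (F (Suc i - k) (k + m - 1)) \<sigma> +
         (F (Suc i - Suc k) (Suc k + m - 1) \<sigma> + F (Suc i - Suc k) (Suc k + m - 1) (simplex_map (k + m) flip \<sigma>)))"
        using cup_flip_add_coboundary[OF w_co w_flip \<sigma> Suc, of "Suc i - k" b]
        unfolding c_def c0_def u'_def u_def F_def[abs_def] b'_def by simp
    next
      fix \<sigma>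
      show "F (Suc i - Suc i) (Suc i + m - 1) \<sigma> = 0"
        using Suc by (simp add: F_def cup_0)
    qed
  qed
  also have "\<dots> = 0"
  proof -
    let ?\<C> = "{V, {x \<in> topspace ?N. flip x \<in> V}}"
    \<comment> \<open>The faces of a simplex in \<open>V\<close> lie in \<open>V\<close>, where
      \<open>u\<close> is zero; those of a simplex in the flipped set are carried by
      \<open>flip\<close> into \<open>V\<close>, so \<open>u'\<close> is zero on them.\<close>
    have small: "c k \<sigma> = 0" if \<sigma>: "singular_simplex (k + m) ?N \<sigma>" "U \<in> ?\<C>" "\<sigma> \<in> standard_simplex (k + m) \<rightarrow> U" for k \<sigma> U
    proof -
      have u0: "u \<tau> = 0" if "singular_simplex p (subtopology ?N V) \<tau>" for \<tau>
        using b[OF that] by (simp add: u_def w_def)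
      have sU: "singular_simplex (k + m) (subtopology ?N U) \<sigma>"
        using \<sigma>(1,3) unfolding singular_simplex_subtopology by blast
      show ?thesis
      proof (cases "U = V")
        case True
        then have "c k \<sigma> = cup (Suc i - k) ?P ?P (k + m) (\<lambda>_. 0) u' \<sigma>"
          unfolding c_def using sU u0 by (intro cup_cong[of _ "subtopology ?N V"]) auto
        then show ?thesis by simp
      next
        case False
        then have U: "U = {x \<in> topspace ?N. flip x \<in> V}"
          using \<sigma>(2) by blast
        have "u' \<tau> = 0" if "singular_simplex p (subtopology ?N U) \<tau>" for \<tau>
        proof -
          have "singular_simplex p ?N \<tau>" "\<tau> ` standard_simplex p \<subseteq> U"
            using that by (auto simp: singular_simplex_subtopology)
          then have "singular_simplex p (subtopology ?N V) (simplex_map p flip \<tau>)"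
            using singular_simplex_flip[of p i Y \<tau>]
            by (force simp: singular_simplex_subtopology U simplex_map_def)
          then show ?thesis
            by (simp add: u'_def u0)
        qed
        then have "c k \<sigma> = cup (Suc i - k) ?P ?P (k + m) u (\<lambda>_. 0) \<sigma>"
          unfolding c_def using sU by (intro cup_cong[of _ "subtopology ?N U"]) auto
        then show ?thesis by simp
      qed
    qed
    \<comment> \<open>A finite set containing all prisms that occur in the sums for
      \<open>k \<le> i\<close>, so that one \<open>r\<close> subdivides all of them finely enough.
      It contains all vertex lists of the right length, shuffle paths or not.\<close>
    define A where "A = (SIGMA k:{..i}. (\<lambda>(\<tau>, M, l). sphere_prism M \<tau> l) `
      (S \<times> Pow {..<k} \<times> {l. set l \<subseteq> {..k} \<times> {..m} \<and> length l = Suc (k + m)}))"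
    have "finite A"
      unfolding A_def using \<open>finite S\<close> by (intro finite_SigmaI finite_imageI finite_cartesian_product finite_lists_length_eq) auto
    moreover have "\<forall>x\<in>A. eventually (\<lambda>r. eval_chain (c (fst x)) ((singular_subdivision (fst x + m) ^^ r) (frag_of (snd x))) = 0) sequentially"
    proof
      fix x assume "x \<in> A"
      then obtain k \<tau> M l where x: "x = (k, sphere_prism M \<tau> l)" "k \<le> i" "\<tau> \<in> S"
        "set l \<subseteq> {..k} \<times> {..m}" "length l = Suc (k + m)"
        by (auto simp: A_def)
      have "set l \<subseteq> {..i} \<times> {..m}"
        using x by fastforce
      then have ch: "singular_chain (k + m) ?N (frag_of (snd x))"
        using singular_simplex_sphere_prism[OF S[OF x(3)] x(5)] by (simp add: x(1) singular_chain_of)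
      have open_C: "openin ?N U" if "U \<in> ?\<C>" for U
        using that V openin_continuous_map_preimage[OF continuous_map_flip V] by auto
      have cover_C: "topspace ?N \<subseteq> \<Union>?\<C>"
        using cover by auto
      obtain r0 where r0: "\<And>r f. \<lbrakk>r0 \<le> r; f \<in> Poly_Mapping.keys ((singular_subdivision (k + m) ^^ r) (frag_of (snd x)))\<rbrakk>
          \<Longrightarrow> \<exists>U\<in>?\<C>. f \<in> standard_simplex (k + m) \<rightarrow> U"
        by (rule sufficient_iterated_singular_subdivision_exists[OF open_C cover_C ch], assumption) (rule that)
      have "eval_chain (c k) ((singular_subdivision (k + m) ^^ r) (frag_of (snd x))) = 0" if r: "r0 \<le> r" for r
      proof -
        have "c k f = 0" if f: "f \<in> Poly_Mapping.keys ((singular_subdivision (k + m) ^^ r) (frag_of (snd x)))" for f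
        proof -
          have "singular_simplex (k + m) ?N f"
            using singular_chain_iterated_subdivision[OF ch, of r] f by (auto simp: singular_chain_def)
          then show ?thesis
            using r0[OF r f] small by blast
        qed
        then show ?thesis
          by (simp add: eval_chain_def)
      qed
      then show "eventually (\<lambda>r. eval_chain (c (fst x)) ((singular_subdivision (fst x + m) ^^ r) (frag_of (snd x))) = 0) sequentially"
        unfolding eventually_sequentially using x(1) by auto
    qed
    ultimately have "eventually (\<lambda>r. \<forall>x\<in>A. eval_chain (c (fst x)) ((singular_subdivision (fst x + m) ^^ r) (frag_of (snd x))) = 0) sequentially"
      by (rule eventually_ball_finite)
    then obtain r where r: "\<And>x. x \<in> A \<Longrightarrow> eval_chain (c (fst x)) ((singular_subdivision (fst x + m) ^^ r) (frag_of (snd x))) = 0"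
      unfolding eventually_sequentially by blast
    have "sphere_cross S m k (\<lambda>\<sigma>. eval_chain (c k) ((singular_subdivision (k + m) ^^ r) (frag_of \<sigma>))) = sphere_cross S m k (\<lambda>_. 0)"
      if "k \<le> i" for k
    proof (rule sphere_cross_cong_prism)
      fix \<tau> M l
      assume "\<tau> \<in> S" "M \<subseteq> {..<k}" "length l = Suc (k + m)" "set l \<subseteq> {..k} \<times> {..m}"
      then have "(k, sphere_prism M \<tau> l) \<in> A"
        using that by (force simp: A_def)
      from r[OF this] show "eval_chain (c k) ((singular_subdivision (k + m) ^^ r) (frag_of (sphere_prism M \<tau> l))) = 0"
        by simp
    qed
    moreover have "(\<Sum>k\<le>i. sphere_cross S m k (c k)) =
        (\<Sum>k\<le>i. sphere_cross S m k (\<lambda>\<sigma>. eval_chain (c k) ((singular_subdivision (k + m) ^^ r) (frag_of \<sigma>))))"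
    proof (rule sum_sphere_cross_subdivision[OF cyc S])
      fix k \<sigma>
      assume "singular_simplex (Suc (k + m)) ?N \<sigma>"
      then show "cobd (Suc (k + m)) (c k) \<sigma> = c (Suc k) \<sigma> + c (Suc k) (simplex_map (Suc (k + m)) flip \<sigma>)"
        using cobd_cup_flip[OF u_co, where J = "Suc i - k"] by (simp add: c_def u'_def)
    next
      fix \<sigma>
      show "c (Suc i) \<sigma> = 0"
        by (simp add: c_def cup_0)
    qed
    ultimately show ?thesis
      by simp
  qed
  finally show "(\<Sum>\<tau>\<in>S. cup (Suc i) ?P ?P m a a \<tau>) = 0" .
qed

subsection \<open>Cohomology classes\<close>

lemma coboundary_eq_cobd:
  "coboundary q X \<phi> = (\<lambda>\<sigma>. if singular_simplex (Suc q) X \<sigma> then cobd (Suc q) \<phi> \<sigma> else 0)"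
  by (simp add: coboundary_def cobd_def fun_eq_iff)

text \<open>\<open>g\<close> need not be normalised, since faces of singular simplices are singular
  simplices. For \<open>n = 0\<close> both sides say that the cochain is zero.\<close>

lemma mem_coboundaries_iff:
  "\<psi> \<in> coboundaries n X \<longleftrightarrow> (\<exists>g. \<psi> = (\<lambda>\<sigma>. if singular_simplex n X \<sigma> then cobd n g \<sigma> else 0))"
proof (cases n)
  case 0
  then show ?thesis
    by (simp add: coboundaries_def cobd_def fun_eq_iff cong: if_cong)
next
  case (Suc q)
  have "coboundary q X g \<in> coboundaries n X" for g
  proof -
    let ?g = "\<lambda>\<tau>. if singular_simplex q X \<tau> then g \<tau> else 0"
    have "coboundary q X g = coboundary q X ?g"
      unfolding coboundary_eq_cobd fun_eq_iff using cobd_cong[of "Suc q" X _ g ?g] by simp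
    then show ?thesis
      by (auto simp: coboundaries_def Suc cochain_group_def)
  qed
  then show ?thesis
    unfolding coboundary_eq_cobd Suc by (auto simp: coboundaries_def coboundary_eq_cobd)
qed

lemma zero_in_coboundaries: "(\<lambda>\<sigma>. 0) \<in> coboundaries n X"
  unfolding mem_coboundaries_iff by (intro exI[of _ "\<lambda>_. 0"] ext) simp

lemma add_in_coboundaries:
  "\<lbrakk>\<phi> \<in> coboundaries n X; \<psi> \<in> coboundaries n X\<rbrakk> \<Longrightarrow> (\<lambda>\<sigma>. \<phi> \<sigma> + \<psi> \<sigma>) \<in> coboundaries n X"
  unfolding mem_coboundaries_iff
proof (elim exE)
  fix g h
  assume "\<phi> = (\<lambda>\<sigma>. if singular_simplex n X \<sigma> then cobd n g \<sigma> else 0)"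
    and "\<psi> = (\<lambda>\<sigma>. if singular_simplex n X \<sigma> then cobd n h \<sigma> else 0)"
  then show "\<exists>g. (\<lambda>\<sigma>. \<phi> \<sigma> + \<psi> \<sigma>) = (\<lambda>\<sigma>. if singular_simplex n X \<sigma> then cobd n g \<sigma> else 0)"
    by (intro exI[of _ "\<lambda>\<sigma>. g \<sigma> + h \<sigma>"]) (simp add: cobd_add fun_eq_iff)
qed

lemma cohomology_class_eq: "cohomology_class n X x = (\<lambda>h \<sigma>. h \<sigma> + x \<sigma>) ` coboundaries n X"
  by (auto simp: cohomology_class_def r_coset_def cocycle_group_def cochain_group_def)

lemma mem_cohomology_class: "x \<in> cohomology_class n X x"
  unfolding cohomology_class_eq by (rule image_eqI[OF _ zero_in_coboundaries]) simp

lemma cohomology_class_coboundary: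
  assumes "x \<in> coboundaries n X"
  shows "cohomology_class n X x = coboundaries n X"
proof
  show "cohomology_class n X x \<subseteq> coboundaries n X"
    using assms by (auto simp: cohomology_class_eq intro: add_in_coboundaries)
  show "coboundaries n X \<subseteq> cohomology_class n X x"
  proof
    fix h assume "h \<in> coboundaries n X"
    then have "(\<lambda>\<sigma>. h \<sigma> + x \<sigma>) \<in> coboundaries n X"
      using assms by (rule add_in_coboundaries)
    then show "h \<in> cohomology_class n X x"
      unfolding cohomology_class_eq by (rule image_eqI[rotated]) (simp add: fun_eq_iff add.assoc)
  qed
qed

lemma one_cohomology_group: "\<one>\<^bsub>cohomology_group n X\<^esub> = coboundaries n X"
  by (simp add: cohomology_group_def FactGroup_def)

lemma mem_carrier_cohomology_group:
  assumes "\<alpha> \<in> carrier (cohomology_group p X)"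
  shows "\<alpha> \<noteq> {}" "\<And>a \<sigma>. \<lbrakk>a \<in> \<alpha>; singular_simplex (Suc p) X \<sigma>\<rbrakk> \<Longrightarrow> cobd (Suc p) a \<sigma> = 0"
proof -
  obtain a0 where a0: "coboundary p X a0 = (\<lambda>\<sigma>. 0)" "\<alpha> = cohomology_class p X a0"
    using assms
    by (auto simp: cohomology_group_def FactGroup_def RCOSETS_def cohomology_class_def cocycle_group_def)
  then show "\<alpha> \<noteq> {}"
    using mem_cohomology_class by blast
  fix a \<sigma>
  assume "a \<in> \<alpha>" and \<sigma>: "singular_simplex (Suc p) X \<sigma>"
  then obtain h where h: "h \<in> coboundaries p X" "a = (\<lambda>\<sigma>. h \<sigma> + a0 \<sigma>)"
    by (auto simp: a0 cohomology_class_eq)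
  obtain g where g: "h = (\<lambda>\<sigma>. if singular_simplex p X \<sigma> then cobd p g \<sigma> else 0)"
    using h(1) mem_coboundaries_iff by blast
  have "cobd (Suc p) h \<sigma> = cobd (Suc p) (cobd p g) \<sigma>"
    by (rule cobd_cong[OF \<sigma>]) (simp add: g)
  also have "\<dots> = 0"
    by (rule cobd_cobd[OF \<sigma>])
  finally have "cobd (Suc p) h \<sigma> = 0" .
  moreover have "cobd (Suc p) a0 \<sigma> = 0"
    using fun_cong[OF a0(1), of \<sigma>] \<sigma> by (simp add: coboundary_eq_cobd)
  ultimately show "cobd (Suc p) a \<sigma> = 0"
    by (simp add: h(2) cobd_add)
qed

text \<open>The pullback is a union over representatives, so for an empty \<open>\<alpha>\<close> it
  would be empty and not the zero class.\<close>

lemma vanishes_onI: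
  assumes "\<alpha> \<noteq> {}"
    and "\<And>a. a \<in> \<alpha> \<Longrightarrow> \<exists>g. \<forall>\<sigma>. singular_simplex n (subtopology X S) \<sigma> \<longrightarrow> a \<sigma> = cobd n g \<sigma>"
  shows "vanishes_on n X S \<alpha>"
proof -
  let ?Y = "subtopology X S"
  have "cohomology_class n ?Y (cochain_pullback n ?Y id a) = coboundaries n ?Y" if "a \<in> \<alpha>" for a
  proof (rule cohomology_class_coboundary)
    obtain g where g: "\<And>\<sigma>. singular_simplex n ?Y \<sigma> \<Longrightarrow> a \<sigma> = cobd n g \<sigma>"
      using assms(2)[OF \<open>a \<in> \<alpha>\<close>] by blast
    have id: "simplex_map n id \<sigma> = \<sigma>" if "singular_simplex n ?Y \<sigma>" for \<sigma>
      using that by (rule simplex_map_id_gen) simp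
    show "cochain_pullback n ?Y id a \<in> coboundaries n ?Y"
      unfolding mem_coboundaries_iff cochain_pullback_def
      by (intro exI[of _ g] ext) (simp add: id g del: simplex_map_id)
  qed
  then show ?thesis
    using assms(1) by (simp add: vanishes_on_def cohomology_pullback_def one_cohomology_group)
qed

lemma vanishes_onD:
  assumes "vanishes_on n X S \<alpha>" "a \<in> \<alpha>"
  shows "\<exists>g. \<forall>\<sigma>. singular_simplex n (subtopology X S) \<sigma> \<longrightarrow> a \<sigma> = cobd n g \<sigma>"
proof -
  let ?Y = "subtopology X S"
  have "cochain_pullback n ?Y id a \<in> coboundaries n ?Y"
    using assms mem_cohomology_class[of "cochain_pullback n ?Y id a" n ?Y]
    unfolding vanishes_on_def cohomology_pullback_def one_cohomology_group by blast
  then obtain g where g: "cochain_pullback n ?Y id a = (\<lambda>\<sigma>. if singular_simplex n ?Y \<sigma> then cobd n g \<sigma> else 0)"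
    using mem_coboundaries_iff by blast
  have "a \<sigma> = cobd n g \<sigma>" if "singular_simplex n ?Y \<sigma>" for \<sigma>
  proof -
    have "simplex_map n id \<sigma> = \<sigma>"
      using that by (rule simplex_map_id_gen) simp
    then show ?thesis
      using fun_cong[OF g, of \<sigma>] that by (simp add: cochain_pullback_def del: simplex_map_id)
  qed
  then show ?thesis
    by blast
qed

subsection \<open>The antipodal core\<close>

text \<open>The sphere sits in the product of countably many lines, as a closed subset of a cube
  that is compact by Tychonoff's theorem.\<close>

lemma compact_space_nsphere: "compact_space (nsphere n)"
proof -
  let ?X = "powertop_real (UNIV :: nat set)"
  let ?S = "{x :: nat \<Rightarrow> real. (\<Sum>i\<le>n. (x i)\<^sup>2) = 1 \<and> (\<forall>i>n. x i = 0)}"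
  have "?S = {x \<in> topspace ?X. (\<Sum>i\<le>n. (x i)\<^sup>2) \<in> {1}} \<inter> (\<Inter>i\<in>{n<..}. {x \<in> topspace ?X. x i \<in> {0}})"
    by auto
  also have "closedin ?X \<dots>"
    by (intro closedin_Int closedin_INT closedin_continuous_map_preimage[where Y = euclideanreal]
        continuous_map_sum continuous_map_real_pow continuous_map_product_projection) auto
  finally have "closedin ?X ?S" .
  moreover have "?S \<subseteq> UNIV \<rightarrow>\<^sub>E {-1..1}"
  proof
    fix x assume x: "x \<in> ?S"
    have "\<bar>x i\<bar> \<le> 1" for i
    proof (cases "i \<le> n")
      case True
      have "(x i)\<^sup>2 \<le> (\<Sum>i\<le>n. (x i)\<^sup>2)"
        using True by (intro member_le_sum) auto
      then show ?thesis
        using x by (simp add: abs_square_le_1)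
    qed (use x in auto)
    then show "x \<in> UNIV \<rightarrow>\<^sub>E {-1..1}"
      by (auto simp: abs_le_iff)
  qed
  moreover have "compactin ?X (UNIV \<rightarrow>\<^sub>E {-1..1})"
    by (simp add: compactin_PiE)
  ultimately have "compactin ?X ?S"
    using closed_compactin by blast
  then show ?thesis
    unfolding nsphere by (rule compact_space_subtopology)
qed

lemma antipode_in_topspace_nsphere: "\<theta> \<in> topspace (nsphere i) \<Longrightarrow> antipode \<theta> \<in> topspace (nsphere i)"
  by (simp add: nsphere antipode_def)

text \<open>This depends on the sphere being nonempty, since an empty intersection would be
  everything.\<close>

lemma antipodal_core_subset: "antipodal_core i X V \<subseteq> topspace X"
  using in_topspace_nsphere[of i] by (fastforce simp: antipodal_core_def slice_def)

text \<open>The complement of the core is the projection of the closed set missed by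
  \<open>V\<close> and its flip, and projection along the compact sphere is a closed map.\<close>

lemma openin_antipodal_core:
  assumes V: "openin (sphere_times i X) V"
  shows "openin X (antipodal_core i X V)"
proof -
  let ?N = "sphere_times i X"
  let ?W = "V \<union> {z \<in> topspace ?N. flip z \<in> V}"
  have "openin ?N ?W"
    using V openin_continuous_map_preimage[OF continuous_map_flip V] by blast
  then have "closedin ?N (topspace ?N - ?W)"
    by blast
  then have "closedin X (snd ` (topspace ?N - ?W))"
    using Abstract_Topological_Spaces.closed_map_snd[OF compact_space_nsphere[of i], of X]
    unfolding closed_map_def by blast
  moreover have "antipodal_core i X V = topspace X - snd ` (topspace ?N - ?W)"
  proof (intro subset_antisym subsetI)
    fix x assume x: "x \<in> antipodal_core i X V"
    have "(\<theta>, x) \<in> V \<or> (antipode \<theta>, x) \<in> V" if "\<theta> \<in> topspace (nsphere i)" for \<theta>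
      using x that by (auto simp: antipodal_core_def slice_def)
    then show "x \<in> topspace X - snd ` (topspace ?N - ?W)"
      using x antipodal_core_subset by fastforce
  next
    fix x assume x: "x \<in> topspace X - snd ` (topspace ?N - ?W)"
    have "(\<theta>, x) \<in> ?W" if "\<theta> \<in> topspace (nsphere i)" for \<theta>
    proof (rule ccontr)
      assume "(\<theta>, x) \<notin> ?W"
      then have "(\<theta>, x) \<in> topspace ?N - ?W"
        using that x by simp
      then show False
        using x by force
    qed
    then show "x \<in> antipodal_core i X V"
      using x by (auto simp: antipodal_core_def slice_def)
  qed
  ultimately show ?thesis
    by (simp add: openin_diff)
qed

section \<open>From cochains to cohomology classes\<close>

lemma lower_square_vanishes_on_antipodal_core:
  assumes \<alpha>: "\<alpha> \<in> carrier (cohomology_group p X)" and V: "openin (sphere_times i X) V"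
    and van: "vanishes_on p (sphere_times i X) V (cohomology_pullback p (sphere_times i X) snd \<alpha>)"
  shows "vanishes_on (2 * p - i) X (antipodal_core i X V) (lower_square i p X \<alpha>)"
proof -
  let ?P = "antipodal_core i X V" and ?m = "2 * p - i"
  let ?Y = "subtopology X ?P"
  have cobY: "\<exists>g. \<forall>\<sigma>. singular_simplex ?m ?Y \<sigma> \<longrightarrow> h \<sigma> = cobd ?m g \<sigma>" if "h \<in> coboundaries ?m X" for h
    using that by (auto simp: mem_coboundaries_iff singular_simplex_subtopology)
  show ?thesis
  proof (cases "i \<le> p")
    case False
    then show ?thesis
      using cobY zero_in_coboundaries[of ?m X]
      by (intro vanishes_onI) (auto simp: lower_square_def one_cohomology_group)
  next
    case True
    then have m: "p + (p - i) = ?m" "p - (p - i) = i"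
      by auto
    have sq: "lower_square i p X \<alpha> = (\<Union>a\<in>\<alpha>. cohomology_class ?m X (cup_i i p p X a a))"
      using True by (simp add: lower_square_def steenrod_square_def m)
    have cup: "\<exists>g. \<forall>\<sigma>. singular_simplex ?m ?Y \<sigma> \<longrightarrow> cup_i i p p X a a \<sigma> = cobd ?m g \<sigma>" if a: "a \<in> \<alpha>" for a
    proof -
      let ?N = "sphere_times i X" and ?M = "sphere_times i ?Y"
      \<comment> \<open>\<open>V\<close> cut down to the part over the core. By the definition of
        the core, \<open>V'\<close> and its flip cover this part.\<close>
      define V' where "V' = V \<inter> (topspace (nsphere i) \<times> ?P)"
      have M: "?M = subtopology ?N (topspace (nsphere i) \<times> ?P)"
        by (simp add: prod_topology_subtopology)
      have "cochain_pullback p ?N snd a \<in> cohomology_pullback p ?N snd \<alpha>"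
        using a mem_cohomology_class by (auto simp: cohomology_pullback_def)
      then obtain b where b: "\<And>\<sigma>. singular_simplex p (subtopology ?N V) \<sigma> \<Longrightarrow> cochain_pullback p ?N snd a \<sigma> = cobd p b \<sigma>"
        using vanishes_onD[OF van] by blast
      have "\<exists>g. \<forall>\<sigma>. singular_simplex ?m ?Y \<sigma> \<longrightarrow> cup (Suc i) (Suc p) (Suc p) ?m a a \<sigma> = cobd ?m g \<sigma>"
      proof (rule cup_square_eq_cobd)
        show "cobd (Suc p) a \<sigma> = 0" if "singular_simplex (Suc p) ?Y \<sigma>" for \<sigma>
          using that mem_carrier_cohomology_group(2)[OF \<alpha> a] by (simp add: singular_simplex_subtopology)
        show "openin ?M V'"
          unfolding M V'_def using V by (simp add: openin_subtopology_Int)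
        show "topspace ?M \<subseteq> V' \<union> flip -` V'"
        proof
          fix z assume "z \<in> topspace ?M"
          then obtain \<theta> x where z: "z = (\<theta>, x)" "\<theta> \<in> topspace (nsphere i)" "x \<in> ?P"
            by auto
          then have "(\<theta>, x) \<in> V \<or> (antipode \<theta>, x) \<in> V"
            by (auto simp: antipodal_core_def slice_def)
          then show "z \<in> V' \<union> flip -` V'"
            using z antipode_in_topspace_nsphere by (auto simp: V'_def)
        qed
        show "a (simplex_map p snd \<sigma>) = cobd p b \<sigma>" if "singular_simplex p (subtopology ?M V') \<sigma>" for \<sigma>
        proof -
          have "singular_simplex p ?N \<sigma>" "singular_simplex p (subtopology ?N V) \<sigma>"
            using that by (auto simp: M V'_def singular_simplex_subtopology)
          then show ?thesis
            using b[of \<sigma>] by (simp add: cochain_pullback_def)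
        qed
      qed
      moreover have "cup_i i p p X a a \<sigma> = cup (Suc i) (Suc p) (Suc p) ?m a a \<sigma>" if "singular_simplex ?m ?Y \<sigma>" for \<sigma>
        using that True by (intro cup_i_eq_cup) (auto simp: singular_simplex_subtopology)
      ultimately show ?thesis
        by simp
    qed
    show ?thesis
    proof (rule vanishes_onI)
      show "lower_square i p X \<alpha> \<noteq> {}"
        using mem_carrier_cohomology_group(1)[OF \<alpha>] mem_cohomology_class unfolding sq by blast
      fix c assume "c \<in> lower_square i p X \<alpha>"
      then obtain a h where ah: "a \<in> \<alpha>" "h \<in> coboundaries ?m X" "c = (\<lambda>\<sigma>. h \<sigma> + cup_i i p p X a a \<sigma>)"
        by (auto simp: sq cohomology_class_eq)
      obtain g g' where "\<And>\<sigma>. singular_simplex ?m ?Y \<sigma> \<Longrightarrow> h \<sigma> = cobd ?m g \<sigma>"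
        "\<And>\<sigma>. singular_simplex ?m ?Y \<sigma> \<Longrightarrow> cup_i i p p X a a \<sigma> = cobd ?m g' \<sigma>"
        using cobY[OF ah(2)] cup[OF ah(1)] by blast
      then show "\<exists>g. \<forall>\<sigma>. singular_simplex ?m ?Y \<sigma> \<longrightarrow> c \<sigma> = cobd ?m g \<sigma>"
        by (intro exI[of _ "\<lambda>\<sigma>. g \<sigma> + g' \<sigma>"]) (simp add: ah(3) cobd_add)
    qed
  qed
qed

theorem mainTheorem2:
  fixes K :: "'a set set" and X :: "('a \<Rightarrow> real) topology"
    and i p :: nat and \<alpha> :: "('a \<Rightarrow> real) cochain set"
    and V :: "((nat \<Rightarrow> real) \<times> ('a \<Rightarrow> real)) set"
  assumes "abstract_simplicial_complex K"
    and "X = geometric_realization K"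
    and "\<alpha> \<in> carrier (cohomology_group p X)"
    and "openin (prod_topology (nsphere i) X) V"
  shows "(vanishes_on p (prod_topology (nsphere i) X) V
            (cohomology_pullback p (prod_topology (nsphere i) X) snd \<alpha>)
          \<longrightarrow> vanishes_on (2 * p - i) X (antipodal_core i X V) (lower_square i p X \<alpha>))
       \<and> openin X (antipodal_core i X V)"
  using lower_square_vanishes_on_antipodal_core[OF assms(3,4)] openin_antipodal_core[OF assms(4)] by blast

end
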